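(* Let $M_k$ be a right module over a ring $k$ having the $(C_2)$ property, and suppose $E=\mathrm{End}(M_k)$ is Dedekind-finite and semi-$\pi$-regular. Then $M$ has the full exchange property.
   Context: A module $N$ has the $(C_2)$ property if every submodule of $N$ isomorphic to a direct summand of $N$ is itself a direct summand of $N$. A ring $E$ is Dedekind-finite if $xy=1$ implies $yx=1$; it is $\pi$-regular if for each $x$ there are $n\ge1$ and $y$ with $x^n=x^nyx^n$; it is semi-$\pi$-regular if $E/J(E)$ is $\pi$-regular and idempotents lift modulo the Jacobson radical $J(E)$. For a cardinal $\aleph$, a module $M_k$ has the $\aleph$-exchange property if whenever $A=M\oplus N=\bigoplus_{i\in I}A_i$ (internal direct sums of submodules of a module $A$) with $|I|\le\aleph$, there are submodules $A_i'\subseteq A_i$ such that $A=M\oplus\bigoplus_{i\in I}A_i'$; $M$ has full exchange if it has $\aleph$-exchange for every cardinal $\aleph$. *)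

theory Defs
  imports "HOL-Algebra.Algebra"
begin

text \<open>A right module: an abelian group (additive part of the record) together with
  a right action ract M x r, read as x r.\<close>
record ('k, 'a) rmod = "'a ring" + ract :: "'a \<Rightarrow> 'k \<Rightarrow> 'a"

definition right_module :: "('k, 'c) ring_scheme \<Rightarrow> ('k, 'a, 'd) rmod_scheme \<Rightarrow> bool" where
  "right_module R M \<longleftrightarrow> ring R \<and> abelian_group M \<and>
     (\<forall>x\<in>carrier M. \<forall>r\<in>carrier R. ract M x r \<in> carrier M) \<and>
     (\<forall>x\<in>carrier M. \<forall>y\<in>carrier M. \<forall>r\<in>carrier R.
         ract M (x \<oplus>\<^bsub>M\<^esub> y) r = ract M x r \<oplus>\<^bsub>M\<^esub> ract M y r) \<and>
     (\<forall>x\<in>carrier M. \<forall>r\<in>carrier R. \<forall>s\<in>carrier R.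
         ract M x (r \<oplus>\<^bsub>R\<^esub> s) = ract M x r \<oplus>\<^bsub>M\<^esub> ract M x s) \<and>
     (\<forall>x\<in>carrier M. \<forall>r\<in>carrier R. \<forall>s\<in>carrier R.
         ract M x (r \<otimes>\<^bsub>R\<^esub> s) = ract M (ract M x r) s) \<and>
     (\<forall>x\<in>carrier M. ract M x \<one>\<^bsub>R\<^esub> = x)"

definition submodule :: "('k, 'c) ring_scheme \<Rightarrow> ('k, 'a, 'd) rmod_scheme \<Rightarrow> 'a set \<Rightarrow> bool" where
  "submodule R M S \<longleftrightarrow> S \<subseteq> carrier M \<and> \<zero>\<^bsub>M\<^esub> \<in> S \<and>
     (\<forall>x\<in>S. \<forall>y\<in>S. x \<oplus>\<^bsub>M\<^esub> y \<in> S) \<and> (\<forall>x\<in>S. \<ominus>\<^bsub>M\<^esub> x \<in> S) \<and>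
     (\<forall>x\<in>S. \<forall>r\<in>carrier R. ract M x r \<in> S)"

definition module_hom_on ::
  "('k, 'c) ring_scheme \<Rightarrow> ('k, 'a, 'd) rmod_scheme \<Rightarrow> 'a set \<Rightarrow> ('k, 'b, 'e) rmod_scheme \<Rightarrow> ('a \<Rightarrow> 'b) \<Rightarrow> bool" where
  "module_hom_on R M S N f \<longleftrightarrow> f \<in> S \<rightarrow> carrier N \<and>
     (\<forall>x\<in>S. \<forall>y\<in>S. f (x \<oplus>\<^bsub>M\<^esub> y) = f x \<oplus>\<^bsub>N\<^esub> f y) \<and>
     (\<forall>x\<in>S. \<forall>r\<in>carrier R. f (ract M x r) = ract N (f x) r)"

definition mod_iso ::
  "('k, 'c) ring_scheme \<Rightarrow> ('k, 'a, 'd) rmod_scheme \<Rightarrow> 'a set \<Rightarrow> ('k, 'b, 'e) rmod_scheme \<Rightarrow> 'b set \<Rightarrow> bool" where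
  "mod_iso R M S N T \<longleftrightarrow> (\<exists>f. module_hom_on R M S N f \<and> bij_betw f S T)"

definition internal_dsum :: "('k, 'a, 'd) rmod_scheme \<Rightarrow> 'i set \<Rightarrow> ('i \<Rightarrow> 'a set) \<Rightarrow> bool" where
  "internal_dsum M I A \<longleftrightarrow>
     (\<forall>a\<in>carrier M. \<exists>F x. finite F \<and> F \<subseteq> I \<and> (\<forall>i\<in>F. x i \<in> A i) \<and>
         a = (\<Oplus>\<^bsub>M\<^esub> i\<in>F. x i)) \<and>
     (\<forall>F x. finite F \<and> F \<subseteq> I \<and> (\<forall>i\<in>F. x i \<in> A i) \<and> (\<Oplus>\<^bsub>M\<^esub> i\<in>F. x i) = \<zero>\<^bsub>M\<^esub>
         \<longrightarrow> (\<forall>i\<in>F. x i = \<zero>\<^bsub>M\<^esub>))"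

definition direct_summand :: "('k, 'c) ring_scheme \<Rightarrow> ('k, 'a, 'd) rmod_scheme \<Rightarrow> 'a set \<Rightarrow> bool" where
  "direct_summand R M S \<longleftrightarrow> submodule R M S \<and>
     (\<exists>T. submodule R M T \<and> internal_dsum M (UNIV :: bool set) (\<lambda>b. if b then S else T))"

definition C2 :: "('k, 'c) ring_scheme \<Rightarrow> ('k, 'a, 'd) rmod_scheme \<Rightarrow> bool" where
  "C2 R M \<longleftrightarrow> (\<forall>S T. submodule R M S \<and> direct_summand R M T \<and> mod_iso R M S M T
                     \<longrightarrow> direct_summand R M S)"

definition End :: "('k, 'c) ring_scheme \<Rightarrow> ('k, 'a, 'd) rmod_scheme \<Rightarrow> ('a \<Rightarrow> 'a) ring" where
  "End R M = \<lparr>carrier = {f. module_hom_on R M (carrier M) M f \<and> f \<in> extensional (carrier M)},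
     monoid.mult = (\<lambda>f g. compose (carrier M) f g),
     monoid.one = (\<lambda>x\<in>carrier M. x),
     ring.zero = (\<lambda>x\<in>carrier M. \<zero>\<^bsub>M\<^esub>),
     ring.add = (\<lambda>f g. \<lambda>x\<in>carrier M. f x \<oplus>\<^bsub>M\<^esub> g x)\<rparr>"

definition dedekind_finite :: "('a, 'b) ring_scheme \<Rightarrow> bool" where
  "dedekind_finite E \<longleftrightarrow> (\<forall>x\<in>carrier E. \<forall>y\<in>carrier E.
       x \<otimes>\<^bsub>E\<^esub> y = \<one>\<^bsub>E\<^esub> \<longrightarrow> y \<otimes>\<^bsub>E\<^esub> x = \<one>\<^bsub>E\<^esub>)"

definition pi_regular :: "('a, 'b) ring_scheme \<Rightarrow> bool" where
  "pi_regular E \<longleftrightarrow> (\<forall>x\<in>carrier E. \<exists>n::nat. n \<ge> 1 \<and> (\<exists>y\<in>carrier E.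
       x [^]\<^bsub>E\<^esub> n = x [^]\<^bsub>E\<^esub> n \<otimes>\<^bsub>E\<^esub> y \<otimes>\<^bsub>E\<^esub> x [^]\<^bsub>E\<^esub> n))"

definition right_ideal :: "'a set \<Rightarrow> ('a, 'b) ring_scheme \<Rightarrow> bool" where
  "right_ideal I E \<longleftrightarrow> additive_subgroup I E \<and>
     (\<forall>a\<in>I. \<forall>r\<in>carrier E. a \<otimes>\<^bsub>E\<^esub> r \<in> I)"

definition maximal_right_ideal :: "'a set \<Rightarrow> ('a, 'b) ring_scheme \<Rightarrow> bool" where
  "maximal_right_ideal I E \<longleftrightarrow> right_ideal I E \<and> I \<noteq> carrier E \<and>
     (\<forall>J. right_ideal J E \<and> I \<subseteq> J \<and> J \<noteq> carrier E \<longrightarrow> J = I)"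

definition jacobson :: "('a, 'b) ring_scheme \<Rightarrow> 'a set" where
  "jacobson E = carrier E \<inter> \<Inter> {I. maximal_right_ideal I E}"

definition idempotents_lift :: "('a, 'b) ring_scheme \<Rightarrow> 'a set \<Rightarrow> bool" where
  "idempotents_lift E J \<longleftrightarrow> (\<forall>x\<in>carrier E. x \<otimes>\<^bsub>E\<^esub> x \<ominus>\<^bsub>E\<^esub> x \<in> J \<longrightarrow>
       (\<exists>e\<in>carrier E. e \<otimes>\<^bsub>E\<^esub> e = e \<and> e \<ominus>\<^bsub>E\<^esub> x \<in> J))"

definition semi_pi_regular :: "('a, 'b) ring_scheme \<Rightarrow> bool" where
  "semi_pi_regular E \<longleftrightarrow> pi_regular (E Quot (jacobson E)) \<and> idempotents_lift E (jacobson E)"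

definition exchange_wrt ::
  "('k, 'c) ring_scheme \<Rightarrow> ('k, 'a, 'd) rmod_scheme \<Rightarrow> ('k, 'b, 'e) rmod_scheme \<Rightarrow> 'i set \<Rightarrow> bool" where
  "exchange_wrt R M A I \<longleftrightarrow>
     (\<forall>M' N Ai. submodule R A M' \<and> submodule R A N \<and> mod_iso R M (carrier M) A M' \<and>
        internal_dsum A (UNIV :: bool set) (\<lambda>b. if b then M' else N) \<and>
        (\<forall>i\<in>I. submodule R A (Ai i)) \<and> internal_dsum A I Ai
      \<longrightarrow> (\<exists>Ai'. (\<forall>i\<in>I. submodule R A (Ai' i) \<and> Ai' i \<subseteq> Ai i) \<and>
              internal_dsum A (insert None (Some ` I)) (case_option M' Ai')))"

end

theory Submission
  imports Defs
begin

text \<open>The proof follows the standard reduction of exchange to partitions of unity: composing the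
  embedding of \<open>M\<close>, the projections onto the \<open>A\<^sub>i\<close> and the projection onto \<open>M\<close> gives a summable family
  \<open>x\<^sub>i\<close> of endomorphisms with sum \<open>1\<close>, and it suffices to find idempotents \<open>e\<^sub>i \<in> E x\<^sub>i\<close> whose ranges are
  independent and whose sum is a unit. The index set is well-ordered and the \<open>e\<^sub>i\<close> are chosen by
  transfinite recursion so that \<open>e\<^sub>i e\<^sub>j \<in> J(E)\<close> for \<open>i < j\<close>.

  At stage \<open>j\<close> let \<open>u\<close> be the sum of the earlier \<open>e\<^sub>k\<close>. The radical is closed in the finite topology, so
  triangularity gives \<open>u\<close> and \<open>u\<^sup>2\<close> the same right annihilator modulo \<open>J(E)\<close>; by \<open>\<pi>\<close>-regularity \<open>u\<close> is
  then regular modulo \<open>J(E)\<close>, and there is an idempotent \<open>f\<close> with \<open>u f \<in> J(E)\<close> and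
  \<open>1 - f \<in> E u + J(E)\<close>. The remaining sum \<open>X = \<Sum>\<^sub>k\<^sub>\<ge>\<^sub>j x\<^sub>k\<close> turns out to be injective on the range of
  \<open>f\<close>, so \<open>(C\<^sub>2)\<close> provides \<open>r\<close> with \<open>r X f = f\<close>, and the finite exchange property splits \<open>e\<^sub>j\<close> off.
  After all stages nothing remains, so \<open>f = 0\<close>, whence the sum of all \<open>e\<^sub>i\<close> is left invertible, and a
  unit by Dedekind-finiteness.\<close>

section \<open>The Jacobson radical\<close>

text \<open>Since \<open>e j\<close> has to be a left multiple of \<open>x j\<close>, it can be
  steered from the left only: \<open>f (e j)\<close> congruent to \<open>e j\<close> puts
  \<open>e k e j\<close> into the radical for earlier \<open>k\<close>, but nothing controls
  \<open>e j e k\<close>. Hence triangularity instead of orthogonality, and hence a well-order,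
  along which annihilators are computed by induction. The second obstacle is the limit stage.
  Earlier stages supply left inverses of the remaining sums, but these need not fit together. What
  survives a limit is injectivity: a vector is moved by finitely many \<open>x k\<close> only, so a
  single earlier stage decides about it. (C2) turns injectivity on a direct summand back into a left
  inverse. Finally, the construction yields congruences modulo the radical, whereas exchange needs
  exact statements about vectors. The bridge is that \<open>1 - j\<close> is a unit for
  \<open>j\<close> in the radical, so that such a \<open>j\<close> fixes no nonzero vector.\<close>

context ring begin

lemmas ring_expand = minus_eq l_distr r_distr l_minus r_minus m_assoc a_ac minus_add r_neg l_neg r_neg1 r_neg2

text \<open>Negation is right multiplication by \<open>- 1\<close>, so closure under it follows from
  the other conditions.\<close>

lemma right_ideal_iff:
  "right_ideal I R \<longleftrightarrow> I \<subseteq> carrier R \<and> \<zero> \<in> I \<and> (\<forall>a\<in>I. \<forall>b\<in>I. a \<oplus> b \<in> I) \<and>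
     (\<forall>a\<in>I. \<forall>r\<in>carrier R. a \<otimes> r \<in> I)" (is "?L \<longleftrightarrow> ?P")
proof
  assume L: ?L
  then interpret additive_subgroup I R by (simp add: right_ideal_def)
  show ?P using L a_subset by (auto simp: right_ideal_def)
next
  assume P: ?P
  have "\<ominus> a \<in> I" if "a \<in> I" for a
  proof -
    have "a \<otimes> \<ominus> \<one> \<in> I" using P that by blast
    moreover have "a \<otimes> \<ominus> \<one> = \<ominus> a" using P that by (auto simp: r_minus)
    ultimately show ?thesis by simp
  qed
  then have "additive_subgroup I R"
    using P by (intro additive_subgroup.intro add.subgroupI) (auto simp: a_inv_def)
  then show ?L using P by (simp add: right_ideal_def)
qed

lemma right_ideal_one: "right_ideal I R \<Longrightarrow> \<one> \<in> I \<Longrightarrow> I = carrier R"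
  unfolding right_ideal_iff by (metis l_one subsetI subset_antisym)

text \<open>Zorn's lemma applies because a right ideal is proper exactly when it misses
  \<open>1\<close>, a property that unions of chains inherit.\<close>

lemma maximal_right_ideal_exists:
  assumes "right_ideal I R" "I \<noteq> carrier R"
  shows "\<exists>K. maximal_right_ideal K R \<and> I \<subseteq> K"
proof -
  define \<A> where "\<A> = {K. right_ideal K R \<and> K \<noteq> carrier R \<and> I \<subseteq> K}"
  have "\<exists>K\<in>\<A>. \<forall>L\<in>\<A>. K \<subseteq> L \<longrightarrow> L = K"
  proof (rule subset_Zorn_nonempty)
    show "\<A> \<noteq> {}" using assms by (auto simp: \<A>_def)
    fix \<C> assume ne: "\<C> \<noteq> {}" and ch: "subset.chain \<A> \<C>"
    have sub: "\<C> \<subseteq> \<A>" using ch by (auto simp: subset_chain_def)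
    have C: "right_ideal K R" "\<one> \<notin> K" "I \<subseteq> K" if "K \<in> \<C>" for K
      using sub that right_ideal_one by (auto simp: \<A>_def)
    have "a \<oplus> b \<in> \<Union>\<C>" if ab: "a \<in> \<Union>\<C>" "b \<in> \<Union>\<C>" for a b
    proof -
      obtain K L where KL: "K \<in> \<C>" "a \<in> K" "L \<in> \<C>" "b \<in> L" using ab by blast
      have "K \<subseteq> L \<or> L \<subseteq> K" using ch KL by (auto simp: subset_chain_def)
      then show ?thesis using KL C(1) unfolding right_ideal_iff by blast
    qed
    moreover have "\<Union>\<C> \<subseteq> carrier R" "\<zero> \<in> \<Union>\<C>" using C(1) ne unfolding right_ideal_iff by blast+
    moreover have "a \<otimes> r \<in> \<Union>\<C>" if "a \<in> \<Union>\<C>" "r \<in> carrier R" for a r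
      using that C(1) unfolding right_ideal_iff by blast
    ultimately have "right_ideal (\<Union>\<C>) R" unfolding right_ideal_iff by blast
    moreover have "\<one> \<notin> \<Union>\<C>" using C(2) by blast
    then have "\<Union>\<C> \<noteq> carrier R" by auto
    moreover have "I \<subseteq> \<Union>\<C>" using C(3) ne by blast
    ultimately show "\<Union>\<C> \<in> \<A>" by (simp add: \<A>_def)
  qed
  then obtain K where K: "K \<in> \<A>" "\<And>L. L \<in> \<A> \<Longrightarrow> K \<subseteq> L \<Longrightarrow> L = K" by blast
  have "maximal_right_ideal K R"
    unfolding maximal_right_ideal_def
  proof (intro conjI allI impI)
    show "right_ideal K R" "K \<noteq> carrier R" using K(1) by (auto simp: \<A>_def)
    fix J assume "right_ideal J R \<and> K \<subseteq> J \<and> J \<noteq> carrier R"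
    then show "J = K" using K by (auto simp: \<A>_def)
  qed
  then show ?thesis using K(1) by (auto simp: \<A>_def)
qed

text \<open>If \<open>1 - y t\<close> has no right inverse, the right ideal it generates lies in a
  maximal one, which cannot contain \<open>y\<close> without containing \<open>1\<close>.
  Conversely, if a maximal \<open>K\<close> misses \<open>y\<close>, then \<open>K + y R\<close> is
  everything, so some \<open>1 - y t\<close> lies in \<open>K\<close> and is not right
  invertible.\<close>

lemma jacobson_iff:
  "y \<in> jacobson R \<longleftrightarrow>
    y \<in> carrier R \<and> (\<forall>t\<in>carrier R. \<exists>s\<in>carrier R. (\<one> \<ominus> y \<otimes> t) \<otimes> s = \<one>)" (is "?L \<longleftrightarrow> ?P")
proof
  assume L: ?L
  then have y: "y \<in> carrier R" by (simp add: jacobson_def)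
  have "\<exists>s\<in>carrier R. (\<one> \<ominus> y \<otimes> t) \<otimes> s = \<one>" if t: "t \<in> carrier R" for t
  proof (rule ccontr)
    assume no: "\<not> ?thesis"
    define a where "a = \<one> \<ominus> y \<otimes> t"
    have a: "a \<in> carrier R" using y t by (simp add: a_def)
    define I where "I = (\<lambda>s. a \<otimes> s) ` carrier R"
    have "right_ideal I R"
      unfolding right_ideal_iff
    proof (intro conjI ballI)
      show "I \<subseteq> carrier R" using a by (auto simp: I_def)
      show "\<zero> \<in> I" unfolding I_def using a by (intro image_eqI[of _ _ \<zero>]) auto
      fix b assume "b \<in> I"
      then obtain s where s: "s \<in> carrier R" "b = a \<otimes> s" by (auto simp: I_def)
      { fix c assume "c \<in> I"
        then obtain s' where s': "s' \<in> carrier R" "c = a \<otimes> s'" by (auto simp: I_def)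
        show "b \<oplus> c \<in> I" unfolding I_def using a s s'
          by (intro image_eqI[of _ _ "s \<oplus> s'"]) (auto simp: r_distr) }
      fix r assume "r \<in> carrier R" then show "b \<otimes> r \<in> I" unfolding I_def using a s
          by (intro image_eqI[of _ _ "s \<otimes> r"]) (auto simp: m_assoc)
    qed
    moreover have "\<one> \<notin> I" using no by (force simp: I_def a_def)
    then have "I \<noteq> carrier R" by auto
    ultimately obtain K where K: "maximal_right_ideal K R" "I \<subseteq> K"
      using maximal_right_ideal_exists by blast
    have KI: "right_ideal K R" "K \<noteq> carrier R" using K by (auto simp: maximal_right_ideal_def)
    have "a \<in> I" unfolding I_def using a by (intro image_eqI[of _ _ \<one>]) auto
    then have "a \<in> K" using K by blast
    moreover have "y \<in> K" using L K by (auto simp: jacobson_def)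
    then have "y \<otimes> t \<in> K" using KI t by (simp add: right_ideal_iff)
    ultimately have "a \<oplus> y \<otimes> t \<in> K" using KI by (simp add: right_ideal_iff)
    moreover have "a \<oplus> y \<otimes> t = \<one>" using y t unfolding a_def by algebra
    ultimately show False using KI right_ideal_one by simp
  qed
  then show ?P using y by blast
next
  assume P: ?P
  have "y \<in> K" if K: "maximal_right_ideal K R" for K
  proof (rule ccontr)
    assume yK: "y \<notin> K"
    have KI: "right_ideal K R" "K \<noteq> carrier R" using K by (auto simp: maximal_right_ideal_def)
    note KR = KI(1)[unfolded right_ideal_iff]
    have y: "y \<in> carrier R" using P by simp
    define I where "I = {k \<oplus> y \<otimes> t |k t. k \<in> K \<and> t \<in> carrier R}"
    have "right_ideal I R"
      unfolding right_ideal_iff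
    proof (intro conjI ballI)
      show "I \<subseteq> carrier R" using y KR by (auto simp: I_def)
      have "\<zero> = \<zero> \<oplus> y \<otimes> \<zero>" using y by simp
      then show "\<zero> \<in> I" unfolding I_def using KR by blast
      fix b assume "b \<in> I"
      then obtain k t where k: "k \<in> K" "t \<in> carrier R" "b = k \<oplus> y \<otimes> t" by (auto simp: I_def)
      then have kc: "k \<in> carrier R" using KR by blast
      { fix c assume "c \<in> I"
        then obtain k' t' where k': "k' \<in> K" "t' \<in> carrier R" "c = k' \<oplus> y \<otimes> t'" by (auto simp: I_def)
        then have k'c: "k' \<in> carrier R" using KR by blast
        have "b \<oplus> c = (k \<oplus> k') \<oplus> y \<otimes> (t \<oplus> t')"
          using k k' kc k'c y by (simp add: r_distr a_ac)
        then show "b \<oplus> c \<in> I" unfolding I_def using KR k k' by blast }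
      fix r assume r: "r \<in> carrier R"
      have "b \<otimes> r = (k \<otimes> r) \<oplus> y \<otimes> (t \<otimes> r)"
        using k kc y r by (simp add: l_distr m_assoc)
      then show "b \<otimes> r \<in> I" unfolding I_def using KR k r by blast
    qed
    moreover have KIs: "K \<subseteq> I"
    proof
      fix k assume "k \<in> K"
      moreover from this have "k = k \<oplus> y \<otimes> \<zero>" using KR y by auto
      ultimately show "k \<in> I" unfolding I_def by blast
    qed
    moreover have "y \<in> I"
    proof -
      have "y = \<zero> \<oplus> y \<otimes> \<one>" using y by simp
      then show ?thesis unfolding I_def using KR by blast
    qed
    then have "I \<noteq> K" using yK by blast
    ultimately have "I = carrier R" using K by (auto simp: maximal_right_ideal_def)
    then have "\<one> \<in> I" by simp
    then obtain k t where k: "k \<in> K" "t \<in> carrier R" "\<one> = k \<oplus> y \<otimes> t" by (auto simp: I_def)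
    then have kc: "k \<in> carrier R" using KR by blast
    have "k = \<one> \<ominus> y \<otimes> t" using k kc y by (simp add: minus_eq a_assoc r_neg)
    then obtain s where "s \<in> carrier R" "k \<otimes> s = \<one>" using P k by blast
    then have "\<one> \<in> K" using KR k by metis
    then show False using KI right_ideal_one by simp
  qed
  then show ?L using P by (auto simp: jacobson_def)
qed

lemma Units_one_minus_jacobson:
  assumes "j \<in> jacobson R"
  shows "\<one> \<ominus> j \<in> Units R"
proof -
  have j: "j \<in> carrier R" and inv: "\<And>t. t \<in> carrier R \<Longrightarrow> \<exists>s\<in>carrier R. (\<one> \<ominus> j \<otimes> t) \<otimes> s = \<one>"
    using assms jacobson_iff by auto
  obtain s where s: "s \<in> carrier R" "(\<one> \<ominus> j) \<otimes> s = \<one>" using inv[of \<one>] j by auto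
  \<comment> \<open>The right inverse \<open>s\<close> equals \<open>1 - j (- s)\<close>, so the
    same criterion gives \<open>s\<close> a right inverse \<open>s'\<close>. Since
    \<open>1 - j\<close> is a left inverse of \<open>s\<close>, it coincides with
    \<open>s'\<close>.\<close>
  obtain s' where s': "s' \<in> carrier R" "(\<one> \<ominus> j \<otimes> (\<ominus> s)) \<otimes> s' = \<one>" using inv[of "\<ominus> s"] s by auto
  have "\<one> \<ominus> j \<otimes> (\<ominus> s) = (\<one> \<ominus> j) \<otimes> s \<oplus> j \<otimes> s" using s(2) s(1) j by (simp add: minus_eq r_minus)
  also have "\<dots> = s" using s(1) j by algebra
  finally have ss': "s \<otimes> s' = \<one>" using s' by simp
  have "\<one> \<ominus> j = (\<one> \<ominus> j) \<otimes> (s \<otimes> s')" using j ss' by simp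
  also have "\<dots> = s'" using s s' j by (simp flip: m_assoc)
  finally have "s \<otimes> (\<one> \<ominus> j) = \<one>" using ss' by simp
  then show ?thesis using s j unfolding Units_def by auto
qed

lemma ideal_jacobson: "ideal (jacobson R) R"
proof (rule idealI)
  show "ring R" by (rule ring_axioms)
  have add: "additive_subgroup (jacobson R) R"
  proof -
    have "right_ideal (jacobson R) R"
      unfolding right_ideal_iff
      by (auto simp: jacobson_def maximal_right_ideal_def right_ideal_iff)
    then show ?thesis by (simp add: right_ideal_def)
  qed
  then show "subgroup (jacobson R) (add_monoid R)" by (rule additive_subgroup.a_subgroup)
next
  fix a x assume a: "a \<in> jacobson R" and x: "x \<in> carrier R"
  have ac: "a \<in> carrier R" using a jacobson_iff by auto
  show "a \<otimes> x \<in> jacobson R"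
    using a x by (simp add: jacobson_iff m_assoc)
  have "\<exists>s\<in>carrier R. (\<one> \<ominus> x \<otimes> a \<otimes> t) \<otimes> s = \<one>" if t: "t \<in> carrier R" for t
  proof -
    \<comment> \<open>Jacobson's formula: a right inverse \<open>c\<close> of
      \<open>1 - a (t x)\<close> yields the right inverse \<open>1 + x c a t\<close> of
      \<open>1 - (x a) t\<close>.\<close>
    obtain c where c: "c \<in> carrier R" "(\<one> \<ominus> a \<otimes> (t \<otimes> x)) \<otimes> c = \<one>"
      using a t x jacobson_iff by (metis m_closed)
    have "(\<one> \<ominus> x \<otimes> a \<otimes> t) \<otimes> (\<one> \<oplus> x \<otimes> c \<otimes> a \<otimes> t)
        = \<one> \<oplus> x \<otimes> ((\<one> \<ominus> a \<otimes> (t \<otimes> x)) \<otimes> c \<ominus> \<one>) \<otimes> (a \<otimes> t)"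
      using ac x t c(1) by (simp add: ring_expand)
    also have "\<dots> = \<one>" unfolding c(2) using ac x t by (simp add: minus_eq r_neg)
    finally show ?thesis using ac x t c(1) by (intro bexI[of _ "\<one> \<oplus> x \<otimes> c \<otimes> a \<otimes> t"]) auto
  qed
  then show "x \<otimes> a \<in> jacobson R"
    using ac x by (simp add: jacobson_iff)
qed

end

section \<open>Exchange in \<open>\<pi>\<close>-regular rings and lifting modulo the radical\<close>

context ring begin

section \<open>Idempotents, regularity and finite exchange from
  \<open>\<pi>\<close>-regularity\<close>

lemma nat_pow_split:
  assumes "z \<in> carrier R" "n \<ge> (1::nat)"
  obtains c where "c \<in> carrier R" "z [^] n = c \<otimes> z" "z [^] n = z \<otimes> c"
proof -
  obtain k where k: "n = Suc k" using assms(2) by (cases n) auto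
  show ?thesis
  proof (rule that)
    show "z [^] k \<in> carrier R" using assms by simp
    show "z [^] n = z [^] k \<otimes> z" using k by simp
    show "z [^] n = z \<otimes> z [^] k" using k assms(1) nat_pow_Suc2 by simp
  qed
qed

lemma pi_regularE:
  assumes "pi_regular R" "z \<in> carrier R"
  obtains n y where "n \<ge> (1::nat)" "y \<in> carrier R" "z [^] n \<otimes> y \<otimes> z [^] n = z [^] n"
  using assms unfolding pi_regular_def by metis

text \<open>The geometric sum \<open>d = 1 + z + ... + z^(n-1)\<close>, used in the corner ring
  where \<open>f\<close> is the identity for \<open>z\<close>. That \<open>d\<close> commutes with
  \<open>z\<close> allows the factors to be swapped when \<open>f = 1\<close>.\<close>

lemma geometric_factor:
  assumes "f \<in> carrier R" "z \<in> carrier R" "f \<otimes> z = z" "z \<otimes> f = z" "n \<ge> (1::nat)"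
  shows "\<exists>d\<in>carrier R. f \<ominus> z [^] n = d \<otimes> (f \<ominus> z) \<and> d \<otimes> z = z \<otimes> d"
  using assms(5)
proof (induction n rule: nat_induct_at_least)
  case base
  show ?case using assms(1,2) by (intro bexI[of _ \<one>]) auto
next
  case (Suc n)
  then obtain d where d: "d \<in> carrier R" "f \<ominus> z [^] n = d \<otimes> (f \<ominus> z)" "d \<otimes> z = z \<otimes> d" by blast
  have "f \<ominus> z [^] (Suc n) = (f \<ominus> z) \<oplus> (f \<ominus> z [^] n) \<otimes> z"
    using assms(1-3) by (simp add: ring_expand)
  also have "\<dots> = (\<one> \<oplus> d \<otimes> z) \<otimes> (f \<ominus> z)"
    unfolding d(2) using assms(1-4) d(1) by (simp add: ring_expand)
  finally have "f \<ominus> z [^] (Suc n) = (\<one> \<oplus> d \<otimes> z) \<otimes> (f \<ominus> z)" .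
  moreover have "(\<one> \<oplus> d \<otimes> z) \<otimes> z = z \<otimes> (\<one> \<oplus> d \<otimes> z)"
  proof -
    have "d \<otimes> z \<otimes> z = z \<otimes> (d \<otimes> z)" using assms(2) d(1,3) by (metis m_assoc)
    then show ?thesis using assms(2) d(1) by (simp add: l_distr r_distr)
  qed
  ultimately show ?case using assms(2) d(1) by (intro bexI[of _ "\<one> \<oplus> d \<otimes> z"]) auto
qed

text \<open>If \<open>z^n\<close> were zero, the geometric sum would be a right inverse of
  \<open>1 - z\<close>. So \<open>z^n\<close> is nonzero, and \<open>z^n y\<close> is the idempotent
  provided by \<open>\<pi>\<close>-regularity.\<close>

lemma pi_regular_nonzero_idempotent:
  assumes "pi_regular R" and z: "z \<in> carrier R" and no: "\<And>s. s \<in> carrier R \<Longrightarrow> (\<one> \<ominus> z) \<otimes> s \<noteq> \<one>"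
  shows "\<exists>t\<in>carrier R. (z \<otimes> t) \<otimes> (z \<otimes> t) = z \<otimes> t \<and> z \<otimes> t \<noteq> \<zero>"
proof -
  obtain n y where n: "n \<ge> (1::nat)" and y: "y \<in> carrier R" and
    reg: "z [^] n \<otimes> y \<otimes> z [^] n = z [^] n" using pi_regularE assms(1) z by blast
  obtain c where c: "c \<in> carrier R" "z [^] n = z \<otimes> c" using nat_pow_split z n by blast
  obtain d where d: "d \<in> carrier R" "\<one> \<ominus> z [^] n = d \<otimes> (\<one> \<ominus> z)" "d \<otimes> z = z \<otimes> d"
    using geometric_factor[of \<one> z n] z n by auto
  have "z [^] n \<noteq> \<zero>"
  proof
    assume "z [^] n = \<zero>"
    then have "\<one> = d \<otimes> (\<one> \<ominus> z)" using d(2) by (simp add: minus_eq)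
    also have "\<dots> = (\<one> \<ominus> z) \<otimes> d" using d(1,3) z by (simp add: ring_expand)
    finally show False using no d(1) by metis
  qed
  moreover have "z \<otimes> (c \<otimes> y) = z [^] n \<otimes> y" using c y z by (simp add: m_assoc)
  moreover have "z [^] n \<otimes> y \<noteq> \<zero>" using reg \<open>z [^] n \<noteq> \<zero>\<close> z by force
  moreover have "(z [^] n \<otimes> y) \<otimes> (z [^] n \<otimes> y) = z [^] n \<otimes> y \<otimes> z [^] n \<otimes> y"
    using z y by (simp add: m_assoc)
  then have "(z [^] n \<otimes> y) \<otimes> (z [^] n \<otimes> y) = z [^] n \<otimes> y" using reg by simp
  ultimately show ?thesis using c y by (intro bexI[of _ "c \<otimes> y"]) auto
qed

text \<open>By \<open>ann\<close>, every right annihilator of a power \<open>u^n\<close> already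
  annihilates \<open>u\<close>. One such annihilator is \<open>1 - y u^n\<close>, hence
  \<open>u = u y u^n\<close>, and the last power ends in a factor \<open>u\<close>.\<close>

lemma pi_regular_imp_regular:
  assumes "pi_regular R" and u: "u \<in> carrier R"
    and ann: "\<And>y. y \<in> carrier R \<Longrightarrow> u \<otimes> (u \<otimes> y) = \<zero> \<Longrightarrow> u \<otimes> y = \<zero>"
  shows "\<exists>w\<in>carrier R. u \<otimes> w \<otimes> u = u"
proof -
  obtain n y where n: "n \<ge> (1::nat)" and y: "y \<in> carrier R" and
    reg: "u [^] n \<otimes> y \<otimes> u [^] n = u [^] n" using pi_regularE assms(1) u by blast
  have pow: "u \<otimes> x = \<zero>" if "u [^] n \<otimes> x = \<zero>" "x \<in> carrier R" for x
    using n that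
  proof (induction n arbitrary: x rule: nat_induct_at_least)
    case base
    then show ?case using u by simp
  next
    case (Suc n)
    then have "u [^] n \<otimes> (u \<otimes> x) = \<zero>" using u by (simp add: m_assoc)
    then show ?case using Suc u ann by simp
  qed
  obtain c where c: "c \<in> carrier R" "u [^] n = c \<otimes> u" using nat_pow_split u n by blast
  have "u [^] n \<otimes> (\<one> \<ominus> y \<otimes> u [^] n) = \<zero>"
    using u y reg by (simp add: r_distr minus_eq r_minus r_neg flip: m_assoc)
  then have "u \<otimes> (\<one> \<ominus> y \<otimes> u [^] n) = \<zero>" using pow u y by simp
  then have "u \<ominus> u \<otimes> (y \<otimes> c) \<otimes> u = \<zero>"
    unfolding c(2) using u y c(1) by (simp add: ring_expand)
  then have "u \<otimes> (y \<otimes> c) \<otimes> u = u" using u y c(1) by (metis m_closed r_right_minus_eq)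
  then show ?thesis using y c(1) by blast
qed

text \<open>If \<open>g = y z\<^sup>n\<close> with \<open>z\<^sup>n y z\<^sup>n = z\<^sup>n\<close>, then \<open>e = g + (1 - g) z\<^sup>n\<close> is an idempotent multiple of
  \<open>z\<close> and \<open>f - e = (f - g) (f - z\<^sup>n)\<close> is a multiple of \<open>f - z\<close>.\<close>

lemma pi_regular_exchange:
  assumes "pi_regular R" and f: "f \<in> carrier R" "f \<otimes> f = f"
    and r: "r \<in> carrier R" and x: "x \<in> carrier R" and x': "x' \<in> carrier R"
    and eq: "r \<otimes> (x \<oplus> x') \<otimes> f = f"
  shows "\<exists>a\<in>carrier R. \<exists>q\<in>carrier R. (a \<otimes> x) \<otimes> (a \<otimes> x) = a \<otimes> x \<and> f \<otimes> (a \<otimes> x) = a \<otimes> x \<and>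
    (a \<otimes> x \<oplus> q \<otimes> x') \<otimes> f = f"
proof -
  \<comment> \<open>Inside the corner ring of \<open>f\<close>, the hypothesis splits
    \<open>f\<close> into the contribution \<open>z\<close> of \<open>x\<close> and the contribution
    \<open>f - z\<close> of \<open>x'\<close>.\<close>
  define z where "z = f \<otimes> r \<otimes> x \<otimes> f"
  have z: "z \<in> carrier R" using f r x by (simp add: z_def)
  have fz: "f \<otimes> z = z" using f r x by (simp add: z_def flip: m_assoc)
  have zf: "z \<otimes> f = z" using f r x by (simp add: z_def m_assoc)
  have fmz: "f \<ominus> z = f \<otimes> r \<otimes> x' \<otimes> f"
  proof -
    have "f = f \<otimes> (r \<otimes> (x \<oplus> x') \<otimes> f)" unfolding eq by (simp add: f)
    also have "\<dots> = z \<oplus> f \<otimes> r \<otimes> x' \<otimes> f" using f r x x' by (simp add: z_def ring_expand)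
    finally have "f \<ominus> z = z \<oplus> f \<otimes> r \<otimes> x' \<otimes> f \<ominus> z" by simp
    also have "\<dots> = f \<otimes> r \<otimes> x' \<otimes> f" using f(1) r x' z by (simp add: ring_expand)
    finally show ?thesis .
  qed
  obtain n y where n: "n \<ge> (1::nat)" and y: "y \<in> carrier R" and
    reg: "z [^] n \<otimes> y \<otimes> z [^] n = z [^] n" using pi_regularE assms(1) z by blast
  define s where "s = z [^] n"
  have s: "s \<in> carrier R" using z by (simp add: s_def)
  obtain c where c: "c \<in> carrier R" "s = c \<otimes> z" using nat_pow_split z n unfolding s_def by metis
  obtain c' where c': "c' \<in> carrier R" "s = z \<otimes> c'" using nat_pow_split z n unfolding s_def by metis
  have fs: "f \<otimes> s = s" using c' fz f z by (simp flip: m_assoc)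
  have sf: "s \<otimes> f = s" using c zf f z by (simp add: m_assoc)
  have sys: "s \<otimes> (y \<otimes> s) = s" using reg s y by (simp add: s_def m_assoc)
  define g where "g = f \<otimes> y \<otimes> s"
  have g: "g \<in> carrier R" using f y s by (simp add: g_def)
  have fg: "f \<otimes> g = g" using f y s by (simp add: g_def flip: m_assoc)
  have gf: "g \<otimes> f = g" using f y s sf by (simp add: g_def m_assoc)
  have sg: "s \<otimes> g = s" using f y s sf sys by (simp add: g_def flip: m_assoc)
  have gg: "g \<otimes> g = g"
  proof -
    have "g \<otimes> g = f \<otimes> y \<otimes> (s \<otimes> g)" using f y s g unfolding g_def by (simp add: m_assoc)
    then show ?thesis using sg by (simp add: g_def)
  qed
  \<comment> \<open>Since \<open>c z = s\<close>, this \<open>b\<close> is the left factor that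
    exhibits \<open>g + (1 - g) s\<close> as a multiple of \<open>z\<close>.\<close>
  define b where "b = (f \<otimes> y \<oplus> \<one> \<ominus> g) \<otimes> c"
  define e where "e = b \<otimes> z"
  have b: "b \<in> carrier R" using f y g c by (simp add: b_def)
  have e: "e \<in> carrier R" using b z by (simp add: e_def)
  have e_eq: "e = g \<oplus> s \<ominus> g \<otimes> s"
  proof -
    have "e = (f \<otimes> y \<oplus> \<one> \<ominus> g) \<otimes> s" using f y g c z by (simp add: e_def b_def m_assoc)
    also have "\<dots> = g \<oplus> s \<ominus> g \<otimes> s" using f y g s by (simp add: l_distr minus_eq l_minus flip: g_def)
    finally show ?thesis .
  qed
  have se: "s \<otimes> e = s"
    using s g sg by (simp add: e_eq r_distr minus_eq r_minus r_neg a_assoc flip: m_assoc)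
  have ge: "g \<otimes> e = g"
    using s g gg by (simp add: e_eq r_distr minus_eq r_minus r_neg a_assoc flip: m_assoc)
  have ee: "e \<otimes> e = e"
  proof -
    have "e \<otimes> e = g \<otimes> e \<oplus> s \<otimes> e \<ominus> g \<otimes> (s \<otimes> e)" using s g e by (subst e_eq) (simp add: ring_expand)
    then show ?thesis unfolding ge se by (simp flip: e_eq)
  qed
  have fe: "f \<otimes> e = e"
    using s g f fs fg by (simp add: e_eq r_distr minus_eq r_minus flip: m_assoc)
  have ef: "e \<otimes> f = e"
    using s g f sf gf by (simp add: e_eq l_distr minus_eq l_minus m_assoc)
  obtain d where d: "d \<in> carrier R" "f \<ominus> s = d \<otimes> (f \<ominus> z)"
    using geometric_factor[OF f(1) z fz zf n] unfolding s_def by blast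
  have fme: "f \<ominus> e = (f \<ominus> g) \<otimes> d \<otimes> (f \<ominus> z)"
  proof -
    have "f \<ominus> e = (f \<ominus> g) \<otimes> (f \<ominus> s)"
      using s g f fs gf by (simp add: e_eq ring_expand)
    then show ?thesis using d f g z by (simp add: m_assoc)
  qed
  \<comment> \<open>The corner only gives \<open>b z = e\<close>, and \<open>z\<close> ends in
    \<open>f\<close>. Prefixing \<open>e\<close> yields \<open>e a = a\<close> and
    \<open>f a = a\<close> besides \<open>a x f = e\<close>, and these make \<open>a x\<close>
    itself idempotent, without the trailing \<open>f\<close>.\<close>
  define a where "a = e \<otimes> b \<otimes> f \<otimes> r"
  have a: "a \<in> carrier R" using e b f r by (simp add: a_def)
  have fa: "f \<otimes> a = a" using e b f r fe by (simp add: a_def flip: m_assoc)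
  have axf: "a \<otimes> x \<otimes> f = e"
  proof -
    have "a \<otimes> x \<otimes> f = e \<otimes> (b \<otimes> z)" using e b f r x by (simp add: a_def z_def m_assoc)
    then show ?thesis using ee by (simp add: e_def)
  qed
  have ea: "e \<otimes> a = a" using e b f r ee by (simp add: a_def flip: m_assoc)
  have 1: "(a \<otimes> x) \<otimes> (a \<otimes> x) = a \<otimes> x"
  proof -
    have "(a \<otimes> x) \<otimes> (a \<otimes> x) = (a \<otimes> x) \<otimes> ((f \<otimes> a) \<otimes> x)" by (simp add: fa)
    also have "\<dots> = (a \<otimes> x \<otimes> f) \<otimes> a \<otimes> x" using a x f by (simp add: m_assoc)
    also have "\<dots> = a \<otimes> x" by (simp add: axf ea)
    finally show ?thesis .
  qed
  have 2: "f \<otimes> (a \<otimes> x) = a \<otimes> x" using a x f fa by (simp flip: m_assoc)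
  define q where "q = (f \<ominus> g) \<otimes> d \<otimes> f \<otimes> r"
  have q: "q \<in> carrier R" using f g d r by (simp add: q_def)
  have "q \<otimes> x' \<otimes> f = f \<ominus> e"
    unfolding fme fmz using f g d r x' by (simp add: q_def m_assoc)
  then have "(a \<otimes> x \<oplus> q \<otimes> x') \<otimes> f = e \<oplus> (f \<ominus> e)"
    using a x q x' f axf by (simp add: l_distr)
  then have "(a \<otimes> x \<oplus> q \<otimes> x') \<otimes> f = f" using e f(1) a_comm[of e "f \<ominus> e"] by (simp add: minus_eq a_assoc l_neg)
  then show ?thesis using 1 2 a q by blast
qed

end

text \<open>The quotient map modulo the radical, abstracted so that congruences become equations in
  \<open>S\<close> and cosets do not appear.\<close>

locale semi_pi_hom = ring_hom_ring +
  assumes surj: "h ` carrier R = carrier S"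
    and pi_regular: "pi_regular S"
    and lift_idempotent: "s \<in> carrier S \<Longrightarrow> s \<otimes>\<^bsub>S\<^esub> s = s \<Longrightarrow> \<exists>e\<in>carrier R. e \<otimes> e = e \<and> h e = s"
    and kernel_iff: "y \<in> carrier R \<Longrightarrow> h y = \<zero>\<^bsub>S\<^esub> \<longleftrightarrow> y \<in> jacobson R"
begin

lemma lift: "s \<in> carrier S \<Longrightarrow> \<exists>a\<in>carrier R. h a = s"
  by (metis imageE surj)

lemma hom_minus [simp]: "a \<in> carrier R \<Longrightarrow> b \<in> carrier R \<Longrightarrow> h (a \<ominus> b) = h a \<ominus>\<^bsub>S\<^esub> h b"
  by (simp add: R.minus_eq S.minus_eq)

lemma Units_if_hom_one:
  assumes "v \<in> carrier R" "h v = \<one>\<^bsub>S\<^esub>"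
  shows "v \<in> Units R"
proof -
  have "h (\<one> \<ominus> v) = \<zero>\<^bsub>S\<^esub>" using assms by (simp add: S.minus_eq S.r_neg)
  then have "\<one> \<ominus> (\<one> \<ominus> v) \<in> Units R"
    using assms(1) R.Units_one_minus_jacobson kernel_iff[of "\<one> \<ominus> v"] by blast
  moreover have "\<one> \<ominus> (\<one> \<ominus> v) = v" using assms(1) by (simp add: R.ring_expand)
  ultimately show ?thesis by simp
qed

text \<open>Outside the radical some \<open>1 - y t\<close> has no right inverse. Its image has none
  either, because anything mapped to \<open>1\<close> is a unit; so \<open>h (y t)\<close> has a
  nonzero idempotent multiple, which lifts.\<close>

lemma nonzero_idempotent:
  assumes y: "y \<in> carrier R" and nz: "h y \<noteq> \<zero>\<^bsub>S\<^esub>"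
  shows "\<exists>t\<in>carrier R. \<exists>e\<in>carrier R. e \<otimes> e = e \<and> h e = h (y \<otimes> t) \<and> h e \<noteq> \<zero>\<^bsub>S\<^esub>"
proof -
  have "y \<notin> jacobson R" using nz kernel_iff y by simp
  then obtain t where t: "t \<in> carrier R" "\<And>s. s \<in> carrier R \<Longrightarrow> (\<one> \<ominus> y \<otimes> t) \<otimes> s \<noteq> \<one>"
    using y by (subst (asm) R.jacobson_iff) blast
  have no: "(\<one>\<^bsub>S\<^esub> \<ominus>\<^bsub>S\<^esub> h (y \<otimes> t)) \<otimes>\<^bsub>S\<^esub> s \<noteq> \<one>\<^bsub>S\<^esub>" if s: "s \<in> carrier S" for s
  proof
    assume eq: "(\<one>\<^bsub>S\<^esub> \<ominus>\<^bsub>S\<^esub> h (y \<otimes> t)) \<otimes>\<^bsub>S\<^esub> s = \<one>\<^bsub>S\<^esub>"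
    obtain a where a: "a \<in> carrier R" "h a = s" using lift s by blast
    have "h ((\<one> \<ominus> y \<otimes> t) \<otimes> a) = \<one>\<^bsub>S\<^esub>" using eq a y t by simp
    then have "(\<one> \<ominus> y \<otimes> t) \<otimes> a \<in> Units R" using Units_if_hom_one a y t by simp
    then obtain v where "v \<in> carrier R" "((\<one> \<ominus> y \<otimes> t) \<otimes> a) \<otimes> v = \<one>"
      using R.Units_r_inv_ex by blast
    then have "(\<one> \<ominus> y \<otimes> t) \<otimes> (a \<otimes> v) = \<one>" using a y t by (simp add: R.m_assoc)
    then show False using t(2) a \<open>v \<in> carrier R\<close> by blast
  qed
  obtain b where b: "b \<in> carrier S" "(h (y \<otimes> t) \<otimes>\<^bsub>S\<^esub> b) \<otimes>\<^bsub>S\<^esub> (h (y \<otimes> t) \<otimes>\<^bsub>S\<^esub> b) = h (y \<otimes> t) \<otimes>\<^bsub>S\<^esub> b"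
    "h (y \<otimes> t) \<otimes>\<^bsub>S\<^esub> b \<noteq> \<zero>\<^bsub>S\<^esub>"
    using S.pi_regular_nonzero_idempotent[OF pi_regular _ no] y t by fastforce
  obtain c where c: "c \<in> carrier R" "h c = b" using lift b by blast
  obtain e where e: "e \<in> carrier R" "e \<otimes> e = e" "h e = h (y \<otimes> t) \<otimes>\<^bsub>S\<^esub> b"
    using lift_idempotent[OF _ b(2)] b(1) y t by auto
  have "h e = h (y \<otimes> (t \<otimes> c))" using e c b(1) y t by (simp add: S.m_assoc)
  then show ?thesis using e b(3) c t by (intro bexI[of _ "t \<otimes> c"] bexI[of _ e]) auto
qed

text \<open>Solving the exchange problem in \<open>S\<close> and lifting the idempotent is not
  enough, since an arbitrary lift need not be a left multiple of \<open>x\<close>. Conjugation by a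
  unit congruent to \<open>1\<close> repairs this without changing the image.\<close>

lemma exchange_lift:
  assumes f: "f \<in> carrier R" "f \<otimes> f = f"
    and r: "r \<in> carrier R" and x: "x \<in> carrier R" and x': "x' \<in> carrier R"
    and eq: "r \<otimes> (x \<oplus> x') \<otimes> f = f"
  shows "\<exists>a\<in>carrier R. \<exists>q\<in>carrier R. (a \<otimes> x) \<otimes> (a \<otimes> x) = a \<otimes> x \<and> h (f \<otimes> (a \<otimes> x)) = h (a \<otimes> x) \<and>
    h ((a \<otimes> x \<oplus> q \<otimes> x') \<otimes> f) = h f"
proof -
  have "h r \<otimes>\<^bsub>S\<^esub> (h x \<oplus>\<^bsub>S\<^esub> h x') \<otimes>\<^bsub>S\<^esub> h f = h (r \<otimes> (x \<oplus> x') \<otimes> f)"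
    using f(1) r x x' by simp
  moreover have "h f \<otimes>\<^bsub>S\<^esub> h f = h (f \<otimes> f)" using f(1) by simp
  ultimately have "h f \<otimes>\<^bsub>S\<^esub> h f = h f" "h r \<otimes>\<^bsub>S\<^esub> (h x \<oplus>\<^bsub>S\<^esub> h x') \<otimes>\<^bsub>S\<^esub> h f = h f"
    using f(2) eq by simp_all
  then obtain a q where a: "a \<in> carrier S" and q: "q \<in> carrier S"
    and id: "(a \<otimes>\<^bsub>S\<^esub> h x) \<otimes>\<^bsub>S\<^esub> (a \<otimes>\<^bsub>S\<^esub> h x) = a \<otimes>\<^bsub>S\<^esub> h x"
    and fa: "h f \<otimes>\<^bsub>S\<^esub> (a \<otimes>\<^bsub>S\<^esub> h x) = a \<otimes>\<^bsub>S\<^esub> h x"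
    and aq: "(a \<otimes>\<^bsub>S\<^esub> h x \<oplus>\<^bsub>S\<^esub> q \<otimes>\<^bsub>S\<^esub> h x') \<otimes>\<^bsub>S\<^esub> h f = h f"
    using S.pi_regular_exchange[OF pi_regular, of "h f" "h r" "h x" "h x'"] f(1) r x x' by auto
  obtain a0 q' where a0: "a0 \<in> carrier R" "h a0 = a" and q': "q' \<in> carrier R" "h q' = q"
    using lift a q by metis
  obtain e where e: "e \<in> carrier R" "e \<otimes> e = e" "h e = a \<otimes>\<^bsub>S\<^esub> h x"
    using lift_idempotent[OF _ id] a x by auto
  \<comment> \<open>\<open>e v = e a0 x\<close> because \<open>e (1 - e) = 0\<close>; so the
    conjugate of \<open>e\<close> by \<open>v\<close> is the left multiple \<open>w e a0 x\<close>
    of \<open>x\<close>.\<close>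
  define v where "v = \<one> \<ominus> e \<oplus> a0 \<otimes> x"
  have v: "v \<in> carrier R" using e a0 x by (simp add: v_def)
  have hv: "h v = \<one>\<^bsub>S\<^esub>" using e a0 a x by (simp add: v_def S.minus_eq S.a_assoc S.l_neg)
  then have vU: "v \<in> Units R" using Units_if_hom_one v by simp
  define w where "w = inv v"
  have w: "w \<in> carrier R" "w \<otimes> v = \<one>" "v \<otimes> w = \<one>" using vU by (auto simp: w_def)
  have hw: "h w = \<one>\<^bsub>S\<^esub>"
  proof -
    have "h w \<otimes>\<^bsub>S\<^esub> h v = \<one>\<^bsub>S\<^esub>" using w v by (simp flip: hom_mult)
    then show ?thesis using hv w by simp
  qed
  have ev: "e \<otimes> v = e \<otimes> (a0 \<otimes> x)"
  proof -
    have "e \<otimes> v = e \<ominus> e \<otimes> e \<oplus> e \<otimes> (a0 \<otimes> x)" using e(1) a0 x by (simp add: v_def R.r_distr R.minus_eq R.r_minus)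
    then show ?thesis using e a0 x by (simp add: R.minus_eq R.r_neg)
  qed
  define a' where "a' = w \<otimes> e \<otimes> a0"
  have a': "a' \<in> carrier R" using w e a0 by (simp add: a'_def)
  have a'x: "a' \<otimes> x = w \<otimes> e \<otimes> v" using w e a0 x v ev by (simp add: a'_def R.m_assoc)
  have "(w \<otimes> e \<otimes> v) \<otimes> (w \<otimes> e \<otimes> v) = w \<otimes> e \<otimes> (v \<otimes> w) \<otimes> e \<otimes> v"
    using w(1) e(1) v by (simp add: R.m_assoc)
  also have "\<dots> = w \<otimes> (e \<otimes> e) \<otimes> v" using w(1,3) e(1) v by (simp add: R.m_assoc)
  finally have id': "(a' \<otimes> x) \<otimes> (a' \<otimes> x) = a' \<otimes> x" by (simp add: a'x e(2))
  have ha: "h (a' \<otimes> x) = a \<otimes>\<^bsub>S\<^esub> h x"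
    unfolding a'x using w(1) hw hv e a x v by simp
  have ha': "h a' \<otimes>\<^bsub>S\<^esub> h x = a \<otimes>\<^bsub>S\<^esub> h x" using ha a' x by simp
  have "h (f \<otimes> (a' \<otimes> x)) = h (a' \<otimes> x)" using ha' fa f(1) a' x by simp
  moreover have "h ((a' \<otimes> x \<oplus> q' \<otimes> x') \<otimes> f) = h f" using ha' aq q' x' f(1) a' x by simp
  ultimately show ?thesis using id' a' q' by blast
qed

text \<open>With \<open>t\<close> a quasi-inverse of \<open>h u\<close>, the product
  \<open>t (h u)\<close> is idempotent; \<open>f\<close> is the complement of a lift of it. Modulo
  the radical, \<open>f\<close> projects onto what \<open>u\<close> annihilates.\<close>

lemma regular_lift:
  assumes u: "u \<in> carrier R"
    and ann: "\<And>y. y \<in> carrier R \<Longrightarrow> h (u \<otimes> (u \<otimes> y)) = \<zero>\<^bsub>S\<^esub> \<Longrightarrow> h (u \<otimes> y) = \<zero>\<^bsub>S\<^esub>"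
  shows "\<exists>f\<in>carrier R. \<exists>w\<in>carrier R. f \<otimes> f = f \<and> h (u \<otimes> f) = \<zero>\<^bsub>S\<^esub> \<and> h (\<one> \<ominus> f) = h (w \<otimes> u)"
proof -
  have hu: "h u \<in> carrier S" using u by simp
  have "h u \<otimes>\<^bsub>S\<^esub> s = \<zero>\<^bsub>S\<^esub>" if s: "s \<in> carrier S" "h u \<otimes>\<^bsub>S\<^esub> (h u \<otimes>\<^bsub>S\<^esub> s) = \<zero>\<^bsub>S\<^esub>" for s
  proof -
    obtain y where y: "y \<in> carrier R" "h y = s" using lift s(1) by blast
    then show ?thesis using ann[of y] u s(2) by simp
  qed
  then obtain t where t: "t \<in> carrier S" "h u \<otimes>\<^bsub>S\<^esub> t \<otimes>\<^bsub>S\<^esub> h u = h u"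
    using S.pi_regular_imp_regular[OF pi_regular hu] by blast
  obtain w where w: "w \<in> carrier R" "h w = t" using lift t(1) by blast
  have "(t \<otimes>\<^bsub>S\<^esub> h u) \<otimes>\<^bsub>S\<^esub> (t \<otimes>\<^bsub>S\<^esub> h u) = t \<otimes>\<^bsub>S\<^esub> (h u \<otimes>\<^bsub>S\<^esub> t \<otimes>\<^bsub>S\<^esub> h u)"
    using t(1) hu by (simp add: S.m_assoc)
  then obtain e where e: "e \<in> carrier R" "e \<otimes> e = e" "h e = t \<otimes>\<^bsub>S\<^esub> h u"
    using lift_idempotent[of "t \<otimes>\<^bsub>S\<^esub> h u"] t hu by auto
  have "(\<one> \<ominus> e) \<otimes> (\<one> \<ominus> e) = \<one> \<ominus> e \<ominus> (e \<ominus> e \<otimes> e)" using e(1) by (simp add: R.ring_expand)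
  then have "(\<one> \<ominus> e) \<otimes> (\<one> \<ominus> e) = \<one> \<ominus> e" using e(1,2) by (simp add: R.minus_eq R.r_neg)
  moreover have "h (u \<otimes> (\<one> \<ominus> e)) = \<zero>\<^bsub>S\<^esub>"
  proof -
    have "h (u \<otimes> (\<one> \<ominus> e)) = h u \<ominus>\<^bsub>S\<^esub> h u \<otimes>\<^bsub>S\<^esub> t \<otimes>\<^bsub>S\<^esub> h u"
      using u e t(1) hu by (simp add: S.ring_expand)
    then show ?thesis using t(2) hu by (simp add: S.minus_eq S.r_neg)
  qed
  moreover have "\<one> \<ominus> (\<one> \<ominus> e) = e" using e(1) by (simp add: R.ring_expand)
  then have "h (\<one> \<ominus> (\<one> \<ominus> e)) = h (w \<otimes> u)" using e w u by simp
  ultimately show ?thesis using e(1) w(1) by (intro bexI[of _ "\<one> \<ominus> e"] bexI[of _ w]) auto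
qed

end

lemma (in ring) semi_pi_hom_jacobson:
  assumes "semi_pi_regular R"
  shows "semi_pi_hom R (R Quot jacobson R) ((+>) (jacobson R))"
proof -
  have carrier: "carrier (R Quot jacobson R) = (+>) (jacobson R) ` carrier R"
    unfolding FactRing_def A_RCOSETS_def' by (simp only: partial_object.simps UNION_singleton_eq_range)
  have eq: "jacobson R +> a = jacobson R +> b \<longleftrightarrow> a \<ominus> b \<in> jacobson R"
    if "a \<in> carrier R" "b \<in> carrier R" for a b
    using quotient_eq_iff_same_a_r_cos[OF ideal_jacobson that] by (rule sym)
  have mz: "y \<ominus> \<zero> = y" if "y \<in> carrier R" for y using that by (simp add: minus_eq)
  interpret J: ideal "jacobson R" R by (rule ideal_jacobson)
  interpret ring_hom_ring R "R Quot jacobson R" "(+>) (jacobson R)" by (rule J.rcos_ring_hom_ring)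
  show ?thesis
  proof (unfold_locales, goal_cases)
    case 1 show ?case using carrier by simp
  next
    case 2 show ?case using assms by (simp add: semi_pi_regular_def)
  next
    case (3 s)
    then obtain x where x: "x \<in> carrier R" "s = jacobson R +> x" unfolding carrier by blast
    have "jacobson R +> (x \<otimes> x) = jacobson R +> x" using 3 x by simp
    then have "x \<otimes> x \<ominus> x \<in> jacobson R" using eq[of "x \<otimes> x" x] x(1) by blast
    then obtain e where "e \<in> carrier R" "e \<otimes> e = e" "e \<ominus> x \<in> jacobson R"
      using assms x unfolding semi_pi_regular_def idempotents_lift_def by blast
    then show ?case using eq x by blast
  next
    case (4 y)
    then show ?case using eq[of y \<zero>] mz by simp
  qed
qed

section \<open>Finitely supported sums and direct sums\<close>

text \<open>Summing over the support lets families be total functions, with no index set to carry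
  along. It is used for families satisfying \<open>fin_family\<close>.\<close>

definition fsum :: "('a, 'b) ring_scheme \<Rightarrow> ('i \<Rightarrow> 'a) \<Rightarrow> 'a" where
  "fsum G c = finsum G c {i. c i \<noteq> \<zero>\<^bsub>G\<^esub>}"

definition fin_family :: "('a, 'b) ring_scheme \<Rightarrow> ('i \<Rightarrow> 'a) \<Rightarrow> bool" where
  "fin_family G c \<longleftrightarrow> range c \<subseteq> carrier G \<and> finite {i. c i \<noteq> \<zero>\<^bsub>G\<^esub>}"

context abelian_group begin

lemma is_abelian_group: "abelian_group G"
  by unfold_locales

lemma fin_familyI: "(\<And>i. c i \<in> carrier G) \<Longrightarrow> finite {i. c i \<noteq> \<zero>} \<Longrightarrow> fin_family G c"
  by (auto simp: fin_family_def)

lemma fin_familyD: "fin_family G c \<Longrightarrow> c i \<in> carrier G" "fin_family G c \<Longrightarrow> finite {i. c i \<noteq> \<zero>}"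
  by (auto simp: fin_family_def)

lemma fin_familyI': "(\<And>i. c i \<in> carrier G) \<Longrightarrow> (\<And>i. i \<notin> F \<Longrightarrow> c i = \<zero>) \<Longrightarrow> finite F \<Longrightarrow> fin_family G c"
  by (intro fin_familyI) (auto intro: rev_finite_subset)

lemma fsum_eq:
  assumes "finite F" "\<And>i. i \<notin> F \<Longrightarrow> c i = \<zero>" "\<And>i. c i \<in> carrier G"
  shows "fsum G c = finsum G c F"
  unfolding fsum_def
  by (rule add.finprod_mono_neutral_cong_left) (use assms in auto)

lemma fsum_closed [simp, intro]: "fin_family G c \<Longrightarrow> fsum G c \<in> carrier G"
  unfolding fsum_def fin_family_def by (auto intro!: finsum_closed)

lemma fin_family_add:
  assumes "fin_family G c" "fin_family G d" shows "fin_family G (\<lambda>i. c i \<oplus> d i)"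
  by (rule fin_familyI'[where F = "{i. c i \<noteq> \<zero>} \<union> {i. d i \<noteq> \<zero>}"])
    (use assms fin_familyD[OF assms(1)] fin_familyD[OF assms(2)] in auto)

lemma fsum_add:
  assumes c: "fin_family G c" and d: "fin_family G d"
  shows "fsum G (\<lambda>i. c i \<oplus> d i) = fsum G c \<oplus> fsum G d"
proof -
  let ?F = "{i. c i \<noteq> \<zero>} \<union> {i. d i \<noteq> \<zero>}"
  have F: "finite ?F" using c d by (auto simp: fin_family_def)
  have cl: "c i \<in> carrier G" "d i \<in> carrier G" for i using c d by (auto simp: fin_family_def)
  have "fsum G (\<lambda>i. c i \<oplus> d i) = finsum G (\<lambda>i. c i \<oplus> d i) ?F"
    by (rule fsum_eq) (use F cl in auto)
  also have "\<dots> = finsum G c ?F \<oplus> finsum G d ?F" using cl by (intro finsum_addf) auto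
  also have "finsum G c ?F = fsum G c" by (rule fsum_eq[symmetric]) (use F cl in auto)
  also have "finsum G d ?F = fsum G d" by (rule fsum_eq[symmetric]) (use F cl in auto)
  finally show ?thesis .
qed

lemma fsum_zero [simp]: "fsum G (\<lambda>i. \<zero>) = \<zero>"
  by (simp add: fsum_def)

lemma fsum_single:
  assumes "a \<in> carrier G" shows "fsum G (\<lambda>i. if i = j then a else \<zero>) = a"
proof -
  have "fsum G (\<lambda>i. if i = j then a else \<zero>) = finsum G (\<lambda>i. if i = j then a else \<zero>) {j}"
    by (rule fsum_eq) (use assms in auto)
  then show ?thesis using assms by simp
qed

lemma additive_zero_neg:
  assumes "abelian_group H" and h: "h \<in> carrier G \<rightarrow> carrier H"
    "\<And>x y. x \<in> carrier G \<Longrightarrow> y \<in> carrier G \<Longrightarrow> h (x \<oplus> y) = h x \<oplus>\<^bsub>H\<^esub> h y"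
  shows "h \<zero> = \<zero>\<^bsub>H\<^esub>" "x \<in> carrier G \<Longrightarrow> h (\<ominus> x) = \<ominus>\<^bsub>H\<^esub> h x"
proof -
  interpret H: abelian_group H by fact
  have "h \<zero> = h \<zero> \<oplus>\<^bsub>H\<^esub> h \<zero>" using h(2)[of \<zero> \<zero>] by simp
  then show z: "h \<zero> = \<zero>\<^bsub>H\<^esub>" using h(1) H.add.l_cancel_one'[of "h \<zero>" "h \<zero>"] by auto
  assume x: "x \<in> carrier G"
  have "h x \<oplus>\<^bsub>H\<^esub> h (\<ominus> x) = \<zero>\<^bsub>H\<^esub>" using h(2)[of x "\<ominus> x"] x z by (simp add: r_neg)
  then show "h (\<ominus> x) = \<ominus>\<^bsub>H\<^esub> h x"
    using H.minus_equality[of "h (\<ominus> x)" "h x"] H.a_comm[of "h x" "h (\<ominus> x)"]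
      funcset_mem[OF h(1) x] funcset_mem[OF h(1) a_inv_closed[OF x]] by simp
qed

lemma
  assumes H: "abelian_group H" and h: "h \<in> carrier G \<rightarrow> carrier H"
    "\<And>x y. x \<in> carrier G \<Longrightarrow> y \<in> carrier G \<Longrightarrow> h (x \<oplus> y) = h x \<oplus>\<^bsub>H\<^esub> h y"
    and c: "fin_family G c"
  shows fin_family_additive: "fin_family H (\<lambda>i. h (c i))"
    and fsum_additive: "fsum H (\<lambda>i. h (c i)) = h (fsum G c)"
proof -
  interpret H: abelian_group H by fact
  have z: "h \<zero> = \<zero>\<^bsub>H\<^esub>" using additive_zero_neg[OF H h] by blast
  let ?F = "{i. c i \<noteq> \<zero>}"
  have F: "finite ?F" and cl: "c i \<in> carrier G" for i using c by (auto simp: fin_family_def)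
  have hc: "h (c i) \<in> carrier H" for i using cl h by blast
  show "fin_family H (\<lambda>i. h (c i))"
    by (rule H.fin_familyI'[OF _ _ F]) (use hc z in auto)
  have fs: "finsum H (\<lambda>i. h (c i)) F = h (finsum G c F)" if "finite F" for F
    using that
  proof induction
    case empty then show ?case using z by simp
  next
    case (insert i F)
    then show ?case using cl hc h(2) by (simp add: Pi_def)
  qed
  have "fsum H (\<lambda>i. h (c i)) = finsum H (\<lambda>i. h (c i)) ?F"
    by (rule H.fsum_eq[OF F]) (use z hc in auto)
  then show "fsum H (\<lambda>i. h (c i)) = h (fsum G c)" using fs[OF F] by (simp add: fsum_def)
qed

lemma fin_family_minus:
  assumes "fin_family G c" shows "fin_family G (\<lambda>i. \<ominus> c i)"
  by (rule fin_familyI'[where F = "{i. c i \<noteq> \<zero>}"]) (use assms in \<open>auto simp: fin_family_def\<close>)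

lemma fsum_minus:
  assumes "fin_family G c"
  shows "fsum G (\<lambda>i. \<ominus> c i) = \<ominus> fsum G c"
  by (rule fsum_additive) (use assms in \<open>auto simp: minus_add is_abelian_group\<close>)

lemma fsum_bool:
  assumes "c True \<in> carrier G" "c False \<in> carrier G" shows "fsum G c = c True \<oplus> c False"
proof -
  have "fsum G c = finsum G c {True, False}"
    by (rule fsum_eq) (use assms in \<open>auto, metis (full_types)\<close>)
  then show ?thesis using assms by simp
qed

text \<open>In the conclusion of the exchange property, \<open>None\<close> indexes the copy of
  \<open>M\<close>; this separates its term from the others.\<close>

lemma fsum_option:
  assumes "fin_family G c"
  shows "fin_family G (\<lambda>i. c (Some i))" "fsum G c = c None \<oplus> fsum G (\<lambda>i. c (Some i))"
proof -
  let ?F = "{i. c (Some i) \<noteq> \<zero>}"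
  have cl: "c i \<in> carrier G" and fin: "finite {i. c i \<noteq> \<zero>}" for i using assms by (auto simp: fin_family_def)
  have F: "finite ?F" using finite_vimageI[OF fin, of Some] by (simp add: vimage_def)
  show "fin_family G (\<lambda>i. c (Some i))" using F cl by (auto simp: fin_family_def)
  have "fsum G c = finsum G c (insert None (Some ` ?F))"
    proof (rule fsum_eq)
    fix i assume "i \<notin> insert None (Some ` ?F)" then show "c i = \<zero>" by (cases i) auto
  qed (use F cl in auto)
  also have "\<dots> = c None \<oplus> finsum G c (Some ` ?F)"
    by (rule finsum_insert) (use F cl in auto)
  also have "finsum G c (Some ` ?F) = finsum G (\<lambda>i. c (Some i)) ?F"
    by (rule finsum_reindex) (use cl in auto)
  also have "\<dots> = fsum G (\<lambda>i. c (Some i))" by (simp add: fsum_def)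
  finally show "fsum G c = c None \<oplus> fsum G (\<lambda>i. c (Some i))" .
qed

end

text \<open>Extension by zero outside \<open>I\<close> makes uniqueness of a decomposition an
  equality of functions.\<close>

definition family_in :: "('a, 'b) ring_scheme \<Rightarrow> 'i set \<Rightarrow> ('i \<Rightarrow> 'a set) \<Rightarrow> ('i \<Rightarrow> 'a) \<Rightarrow> bool" where
  "family_in G I A c \<longleftrightarrow> (\<forall>i\<in>I. c i \<in> A i) \<and> (\<forall>i. i \<notin> I \<longrightarrow> c i = \<zero>\<^bsub>G\<^esub>) \<and> finite {i. c i \<noteq> \<zero>\<^bsub>G\<^esub>}"

lemma (in abelian_group) family_in_fin_family:
  assumes "\<And>i. i \<in> I \<Longrightarrow> A i \<subseteq> carrier G" "family_in G I A c"
  shows "fin_family G c"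
  using assms unfolding family_in_def fin_family_def by (metis image_subsetI subsetD zero_closed)

text \<open>A pair \<open>F\<close>, \<open>x\<close> from the definition becomes a total family
  after extension by zero; conversely, the support of a family serves as \<open>F\<close>.\<close>

lemma internal_dsum_iff:
  fixes M :: "('k, 'a, 'd) rmod_scheme"
  assumes "abelian_group M" and A: "\<And>i. i \<in> I \<Longrightarrow> A i \<subseteq> carrier M" and z: "\<And>i. i \<in> I \<Longrightarrow> \<zero>\<^bsub>M\<^esub> \<in> A i"
  shows "internal_dsum M I A \<longleftrightarrow>
    (\<forall>a\<in>carrier M. \<exists>c. family_in M I A c \<and> fsum M c = a) \<and>
    (\<forall>c. family_in M I A c \<and> fsum M c = \<zero>\<^bsub>M\<^esub> \<longrightarrow> (\<forall>i. c i = \<zero>\<^bsub>M\<^esub>))"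
proof -
  interpret abelian_group M by fact
  have ext: "family_in M I A (\<lambda>i. if i \<in> F then x i else \<zero>\<^bsub>M\<^esub>)"
    "fsum M (\<lambda>i. if i \<in> F then x i else \<zero>\<^bsub>M\<^esub>) = finsum M x F"
    if F: "finite F" "F \<subseteq> I" "\<forall>i\<in>F. x i \<in> A i" for F x
  proof -
    let ?c = "\<lambda>i. if i \<in> F then x i else \<zero>\<^bsub>M\<^esub>"
    have "finite {i. ?c i \<noteq> \<zero>\<^bsub>M\<^esub>}" by (rule finite_subset[OF _ F(1)]) auto
    then show "family_in M I A ?c" unfolding family_in_def using F z by auto
    have "fsum M ?c = finsum M ?c F" by (rule fsum_eq) (use F A in auto)
    also have "\<dots> = finsum M x F" by (rule finsum_cong') (use F A in auto)
    finally show "fsum M ?c = finsum M x F" .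
  qed
  have res: "finite {i. c i \<noteq> \<zero>\<^bsub>M\<^esub>}" "{i. c i \<noteq> \<zero>\<^bsub>M\<^esub>} \<subseteq> I" "\<forall>i\<in>{i. c i \<noteq> \<zero>\<^bsub>M\<^esub>}. c i \<in> A i"
    if "family_in M I A c" for c
    using that by (auto simp: family_in_def)
  show ?thesis
  proof (intro iffI conjI ballI allI impI)
    fix a assume d: "internal_dsum M I A" and "a \<in> carrier M"
    then obtain F x where "finite F" "F \<subseteq> I" "\<forall>i\<in>F. x i \<in> A i" "a = finsum M x F"
      unfolding internal_dsum_def by blast
    then show "\<exists>c. family_in M I A c \<and> fsum M c = a" using ext[of F x] by blast
  next
    fix c i assume d: "internal_dsum M I A" and c: "family_in M I A c \<and> fsum M c = \<zero>\<^bsub>M\<^esub>"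
    have "\<forall>i\<in>{i. c i \<noteq> \<zero>\<^bsub>M\<^esub>}. c i = \<zero>\<^bsub>M\<^esub>"
      using d res[of c] c unfolding internal_dsum_def fsum_def by meson
    then show "c i = \<zero>\<^bsub>M\<^esub>" by auto
  next
    assume H: "(\<forall>a\<in>carrier M. \<exists>c. family_in M I A c \<and> fsum M c = a) \<and>
      (\<forall>c. family_in M I A c \<and> fsum M c = \<zero>\<^bsub>M\<^esub> \<longrightarrow> (\<forall>i. c i = \<zero>\<^bsub>M\<^esub>))"
    show "internal_dsum M I A" unfolding internal_dsum_def
    proof (intro conjI ballI allI impI)
      fix a assume "a \<in> carrier M"
      then obtain c where "family_in M I A c" "fsum M c = a" using H by blast
      then show "\<exists>F x. finite F \<and> F \<subseteq> I \<and> (\<forall>i\<in>F. x i \<in> A i) \<and> a = finsum M x F"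
        using res[of c] unfolding fsum_def by (intro exI[of _ "{i. c i \<noteq> \<zero>\<^bsub>M\<^esub>}"] exI[of _ c]) auto
    next
      fix F x i assume F: "finite F \<and> F \<subseteq> I \<and> (\<forall>i\<in>F. x i \<in> A i) \<and> finsum M x F = \<zero>\<^bsub>M\<^esub>" and i: "i \<in> F"
      have "family_in M I A (\<lambda>i. if i \<in> F then x i else \<zero>\<^bsub>M\<^esub>)"
        "fsum M (\<lambda>i. if i \<in> F then x i else \<zero>\<^bsub>M\<^esub>) = \<zero>\<^bsub>M\<^esub>"
        using ext[of F x] F by simp_all
      then have "(\<lambda>i. if i \<in> F then x i else \<zero>\<^bsub>M\<^esub>) i = \<zero>\<^bsub>M\<^esub>" using H by blast
      then show "x i = \<zero>\<^bsub>M\<^esub>" using i by simp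
    qed
  qed
qed

section \<open>Right modules, their endomorphism rings and the projections of a direct sum\<close>

locale right_mod =
  fixes R :: "('k, 'c) ring_scheme" and M :: "('k, 'a, 'd) rmod_scheme" (structure)
  assumes right_module: "right_module R M"

sublocale right_mod \<subseteq> abelian_group M
  using right_module by (simp add: right_module_def)

context right_mod begin

abbreviation "E \<equiv> End R M"

lemma ract_closed [simp]: "x \<in> carrier M \<Longrightarrow> r \<in> carrier R \<Longrightarrow> ract M x r \<in> carrier M"
  using right_module by (simp add: right_module_def)

lemma ract_add: "x \<in> carrier M \<Longrightarrow> y \<in> carrier M \<Longrightarrow> r \<in> carrier R \<Longrightarrow>
    ract M (x \<oplus> y) r = ract M x r \<oplus> ract M y r"
  using right_module by (simp add: right_module_def)

lemma ract_zero_minus: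
  assumes r: "r \<in> carrier R"
  shows "ract M \<zero> r = \<zero>" "x \<in> carrier M \<Longrightarrow> ract M (\<ominus> x) r = \<ominus> ract M x r"
  using additive_zero_neg[of M "\<lambda>x. ract M x r"] is_abelian_group r ract_add by auto

lemma End_carrier_iff: "f \<in> carrier E \<longleftrightarrow> f \<in> carrier M \<rightarrow> carrier M \<and> f \<in> extensional (carrier M) \<and>
  (\<forall>x\<in>carrier M. \<forall>y\<in>carrier M. f (x \<oplus> y) = f x \<oplus> f y) \<and>
  (\<forall>x\<in>carrier M. \<forall>r\<in>carrier R. f (ract M x r) = ract M (f x) r)"
  by (auto simp: End_def module_hom_on_def)

lemma End_closed [simp]: "f \<in> carrier E \<Longrightarrow> x \<in> carrier M \<Longrightarrow> f x \<in> carrier M"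
  by (auto simp: End_carrier_iff)

lemma End_add: "f \<in> carrier E \<Longrightarrow> x \<in> carrier M \<Longrightarrow> y \<in> carrier M \<Longrightarrow> f (x \<oplus> y) = f x \<oplus> f y"
  by (auto simp: End_carrier_iff)

lemma End_ract: "f \<in> carrier E \<Longrightarrow> x \<in> carrier M \<Longrightarrow> r \<in> carrier R \<Longrightarrow> f (ract M x r) = ract M (f x) r"
  by (auto simp: End_carrier_iff)

lemma End_zero [simp]: "f \<in> carrier E \<Longrightarrow> f \<zero> = \<zero>"
  and End_uminus: "f \<in> carrier E \<Longrightarrow> x \<in> carrier M \<Longrightarrow> f (\<ominus> x) = \<ominus> f x"
  using additive_zero_neg[of M f] is_abelian_group End_add by auto

lemma End_minus: "f \<in> carrier E \<Longrightarrow> x \<in> carrier M \<Longrightarrow> y \<in> carrier M \<Longrightarrow> f (x \<ominus> y) = f x \<ominus> f y"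
  by (simp add: minus_eq End_add End_uminus)

lemma End_eqI: "f \<in> carrier E \<Longrightarrow> g \<in> carrier E \<Longrightarrow> (\<And>x. x \<in> carrier M \<Longrightarrow> f x = g x) \<Longrightarrow> f = g"
  by (auto simp: End_carrier_iff intro: extensionalityI)

lemma End_mult_eq: "f \<otimes>\<^bsub>E\<^esub> g = compose (carrier M) f g" by (simp add: End_def)
lemma End_one_eq: "\<one>\<^bsub>E\<^esub> = (\<lambda>x\<in>carrier M. x)" by (simp add: End_def)
lemma End_zero_eq: "\<zero>\<^bsub>E\<^esub> = (\<lambda>x\<in>carrier M. \<zero>)" by (simp add: End_def)
lemma End_add_eq: "f \<oplus>\<^bsub>E\<^esub> g = (\<lambda>x\<in>carrier M. f x \<oplus> g x)" by (simp add: End_def)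

lemma End_app [simp]:
  assumes "x \<in> carrier M"
  shows "(f \<otimes>\<^bsub>E\<^esub> g) x = f (g x)" "\<one>\<^bsub>E\<^esub> x = x" "\<zero>\<^bsub>E\<^esub> x = \<zero>" "(f \<oplus>\<^bsub>E\<^esub> g) x = f x \<oplus> g x"
  using assms by (simp_all add: End_mult_eq End_one_eq End_zero_eq End_add_eq compose_def)

lemma restrict_in_End:
  assumes "\<And>x. x \<in> carrier M \<Longrightarrow> f x \<in> carrier M"
    "\<And>x y. x \<in> carrier M \<Longrightarrow> y \<in> carrier M \<Longrightarrow> f (x \<oplus> y) = f x \<oplus> f y"
    "\<And>x r. x \<in> carrier M \<Longrightarrow> r \<in> carrier R \<Longrightarrow> f (ract M x r) = ract M (f x) r"
  shows "(\<lambda>x\<in>carrier M. f x) \<in> carrier E"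
  using assms by (auto simp: End_carrier_iff)

lemma End_ring: "ring E"
proof -
  have mult: "f \<otimes>\<^bsub>E\<^esub> g \<in> carrier E" if "f \<in> carrier E" "g \<in> carrier E" for f g
    unfolding End_mult_eq compose_def using that
    by (intro restrict_in_End) (simp_all add: End_add End_ract)
  have add: "f \<oplus>\<^bsub>E\<^esub> g \<in> carrier E" if "f \<in> carrier E" "g \<in> carrier E" for f g
    unfolding End_add_eq using that
    by (intro restrict_in_End) (simp_all add: End_add End_ract ract_add a_ac)
  have zero: "\<zero>\<^bsub>E\<^esub> \<in> carrier E"
    unfolding End_zero_eq by (intro restrict_in_End) (simp_all add: ract_zero_minus)
  have one: "\<one>\<^bsub>E\<^esub> \<in> carrier E" unfolding End_one_eq by (intro restrict_in_End) simp_all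
  show ?thesis
  proof (rule ringI)
    show "abelian_group E"
    proof (rule abelian_groupI)
      fix f assume f: "f \<in> carrier E"
      have n: "(\<lambda>x\<in>carrier M. \<ominus> f x) \<in> carrier E"
        using f by (intro restrict_in_End) (simp_all add: End_add End_ract minus_add ract_zero_minus)
      have "(\<lambda>x\<in>carrier M. \<ominus> f x) \<oplus>\<^bsub>E\<^esub> f = \<zero>\<^bsub>E\<^esub>"
        by (rule End_eqI) (use n f add zero in \<open>simp_all add: l_neg\<close>)
      then show "\<exists>g\<in>carrier E. g \<oplus>\<^bsub>E\<^esub> f = \<zero>\<^bsub>E\<^esub>" using n by blast
    qed (auto intro!: End_eqI add zero simp: a_ac)
    show "monoid E"
      by (rule monoidI) (auto intro!: End_eqI mult one)
  qed (auto intro!: End_eqI mult add simp: End_add)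
qed

end

sublocale right_mod \<subseteq> E: ring "End R M"
  by (rule End_ring)

context right_mod begin

lemma End_app_uminus [simp]:
  assumes "f \<in> carrier E" "x \<in> carrier M" shows "(\<ominus>\<^bsub>E\<^esub> f) x = \<ominus> f x"
proof -
  have "f x \<oplus> (\<ominus>\<^bsub>E\<^esub> f) x = \<zero>" using assms End_app(3,4) E.r_neg by metis
  then show ?thesis using assms by (metis E.a_inv_closed End_closed a_comm minus_equality)
qed

lemma End_app_minus [simp]:
  assumes "f \<in> carrier E" "g \<in> carrier E" "x \<in> carrier M" shows "(f \<ominus>\<^bsub>E\<^esub> g) x = f x \<ominus> g x"
  using assms by (simp add: E.minus_eq minus_eq)

lemma submodule_iff: "submodule R M S \<longleftrightarrow> S \<subseteq> carrier M \<and> \<zero> \<in> S \<and>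
     (\<forall>x\<in>S. \<forall>y\<in>S. x \<oplus> y \<in> S) \<and> (\<forall>x\<in>S. \<ominus> x \<in> S) \<and> (\<forall>x\<in>S. \<forall>r\<in>carrier R. ract M x r \<in> S)"
  by (simp add: submodule_def)

text \<open>Sums and scalar multiples of decompositions are again decompositions, so by uniqueness
  each coordinate is an endomorphism.\<close>

lemma internal_dsum_projections:
  assumes A: "\<And>i. i \<in> I \<Longrightarrow> submodule R M (A i)" and ds: "internal_dsum M I A"
  obtains p where "\<And>i. p i \<in> carrier E" "\<And>m. m \<in> carrier M \<Longrightarrow> family_in M I A (\<lambda>i. p i m)"
    "\<And>m. m \<in> carrier M \<Longrightarrow> fsum M (\<lambda>i. p i m) = m"
    "\<And>c j. family_in M I A c \<Longrightarrow> p j (fsum M c) = c j"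
proof -
  have sub: "A i \<subseteq> carrier M" "\<zero> \<in> A i" if "i \<in> I" for i using A[OF that] by (auto simp: submodule_def)
  note ds' = ds[unfolded internal_dsum_iff[where I = I and A = A, OF is_abelian_group sub, simplified]]
  have ff: "fin_family M c" if "family_in M I A c" for c
    by (rule family_in_fin_family[OF _ that]) (use sub in auto)
  have uniq: "c = d" if c: "family_in M I A c" and d: "family_in M I A d" and eq: "fsum M c = fsum M d" for c d
  proof -
    have fc: "fin_family M c" "fin_family M d" using ff c d by auto
    have cl: "c i \<in> carrier M" "d i \<in> carrier M" for i using fc by (auto simp: fin_family_def)
    have "fin_family M (\<lambda>i. c i \<oplus> \<ominus> d i)" using fc fin_family_add fin_family_minus by blast
    then have "family_in M I A (\<lambda>i. c i \<oplus> \<ominus> d i)"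
      using c d A unfolding family_in_def fin_family_def submodule_def by (simp add: r_neg)
    moreover have "fsum M (\<lambda>i. c i \<oplus> \<ominus> d i) = \<zero>"
      using fc eq by (simp add: fsum_add fsum_minus fin_family_minus r_neg)
    ultimately have "c i \<oplus> \<ominus> d i = \<zero>" for i using ds' by blast
    then show ?thesis using cl by (metis add.inv_solve_right' ext l_zero r_neg zero_closed)
  qed
  define rep where "rep m = (THE c. family_in M I A c \<and> fsum M c = m)" for m
  have rep: "family_in M I A (rep m)" "fsum M (rep m) = m" if "m \<in> carrier M" for m
  proof -
    have "\<exists>!c. family_in M I A c \<and> fsum M c = m" using ds' that uniq by blast
    from theI'[OF this] show "family_in M I A (rep m)" "fsum M (rep m) = m" by (auto simp: rep_def)
  qed
  have repI: "rep m = c" if "family_in M I A c" "fsum M c = m" for m c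
    using that rep[of m] uniq ff fsum_closed by metis
  define p where "p i = (\<lambda>m\<in>carrier M. rep m i)" for i
  have add: "rep (x \<oplus> y) = (\<lambda>i. rep x i \<oplus> rep y i)" if "x \<in> carrier M" "y \<in> carrier M" for x y
  proof (rule repI)
    have fc: "fin_family M (rep x)" "fin_family M (rep y)" using ff rep that by auto
    then have "fin_family M (\<lambda>i. rep x i \<oplus> rep y i)" using fin_family_add by blast
    then show "family_in M I A (\<lambda>i. rep x i \<oplus> rep y i)"
      using rep(1)[OF that(1)] rep(1)[OF that(2)] A unfolding family_in_def fin_family_def submodule_def by simp
    show "fsum M (\<lambda>i. rep x i \<oplus> rep y i) = x \<oplus> y" using fsum_add[OF fc] rep(2)[OF that(1)] rep(2)[OF that(2)] by simp
  qed
  have ract: "rep (ract M x r) = (\<lambda>i. ract M (rep x i) r)" if "x \<in> carrier M" "r \<in> carrier R" for x r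
  proof (rule repI)
    have fc: "fin_family M (rep x)" using ff rep that by auto
    have h: "(\<lambda>x. ract M x r) \<in> carrier M \<rightarrow> carrier M" using that by auto
    note fa = fin_family_additive[OF is_abelian_group h _ fc] fsum_additive[OF is_abelian_group h _ fc]
    have "fin_family M (\<lambda>i. ract M (rep x i) r)" using fa(1) that ract_add by auto
    then show "family_in M I A (\<lambda>i. ract M (rep x i) r)"
      using rep(1)[OF that(1)] A that unfolding family_in_def fin_family_def submodule_def
      by (simp add: ract_zero_minus)
    show "fsum M (\<lambda>i. ract M (rep x i) r) = ract M x r" using fa(2) that ract_add rep(2) by auto
  qed
  have cl: "rep m i \<in> carrier M" if "m \<in> carrier M" for m i
    using ff[OF rep(1)[OF that]] by (auto simp: fin_family_def)
  have pE: "p i \<in> carrier E" for i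
    unfolding p_def by (rule restrict_in_End) (simp_all add: cl add ract)
  have pm: "(\<lambda>i. p i m) = rep m" if "m \<in> carrier M" for m using that by (auto simp: p_def)
  have "p j (fsum M c) = c j" if c: "family_in M I A c" for c j
    using repI[OF c refl] fsum_closed[OF ff[OF c]] by (simp add: p_def)
  then show thesis using that[of p] pE pm rep by simp
qed

end

section \<open>Summable families of endomorphisms and \<open>(C\<^sub>2)\<close>\<close>

context right_mod begin

text \<open>Pointwise finiteness, that is, summability in the finite topology of the endomorphism
  ring; the family itself may have infinite support.\<close>

definition summable_family :: "('i \<Rightarrow> 'a \<Rightarrow> 'a) \<Rightarrow> bool" where
  "summable_family x \<longleftrightarrow> (\<forall>i. x i \<in> carrier E) \<and> (\<forall>m\<in>carrier M. finite {i. x i m \<noteq> \<zero>})"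

definition esum :: "('i \<Rightarrow> 'a \<Rightarrow> 'a) \<Rightarrow> 'a \<Rightarrow> 'a" where
  "esum x = (\<lambda>m\<in>carrier M. fsum M (\<lambda>i. x i m))"

definition restr :: "'i set \<Rightarrow> ('i \<Rightarrow> 'a \<Rightarrow> 'a) \<Rightarrow> 'i \<Rightarrow> 'a \<Rightarrow> 'a" where
  "restr K x = (\<lambda>i. if i \<in> K then x i else \<zero>\<^bsub>E\<^esub>)"

lemma summable_familyD:
  assumes "summable_family x"
  shows "x i \<in> carrier E" "m \<in> carrier M \<Longrightarrow> finite {i. x i m \<noteq> \<zero>}" "m \<in> carrier M \<Longrightarrow> fin_family M (\<lambda>i. x i m)"
  using assms by (auto simp: summable_family_def fin_family_def)

lemma summable_family_mono:
  assumes "summable_family x" "\<And>i. y i \<in> carrier E" "\<And>m i. m \<in> carrier M \<Longrightarrow> x i m = \<zero> \<Longrightarrow> y i m = \<zero>"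
  shows "summable_family y"
  unfolding summable_family_def
proof (intro conjI allI ballI)
  fix m assume "m \<in> carrier M"
  then show "finite {i. y i m \<noteq> \<zero>}"
    using assms(3) by (intro finite_subset[OF _ summable_familyD(2)[OF assms(1)]]) auto
qed (use assms in auto)

lemma summable_family_mult_left:
  assumes "summable_family x" "\<And>i. a i \<in> carrier E" shows "summable_family (\<lambda>i. a i \<otimes>\<^bsub>E\<^esub> x i)"
  by (rule summable_family_mono[OF assms(1)]) (use assms summable_familyD(1)[OF assms(1)] in auto)

lemma summable_family_mult_right:
  assumes "summable_family x" "b \<in> carrier E" shows "summable_family (\<lambda>i. x i \<otimes>\<^bsub>E\<^esub> b)"
  using assms by (auto simp: summable_family_def)

lemma summable_family_restr:
  assumes "summable_family x" shows "summable_family (restr K x)"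
  by (rule summable_family_mono[OF assms(1)]) (use summable_familyD(1)[OF assms] in \<open>auto simp: restr_def\<close>)

lemma restr_UNIV [simp]: "restr UNIV x = x"
  by (simp add: restr_def)

lemma esum_app: "m \<in> carrier M \<Longrightarrow> esum x m = fsum M (\<lambda>i. x i m)"
  by (simp add: esum_def)

lemma esum_closed:
  assumes x: "summable_family x" shows "esum x \<in> carrier E"
  unfolding esum_def
proof (rule restrict_in_End)
  note xE = summable_familyD(1)[OF x]
  fix m assume m: "m \<in> carrier M"
  show "fsum M (\<lambda>i. x i m) \<in> carrier M" using summable_familyD(3)[OF x m] by (rule fsum_closed)
  { fix n assume n: "n \<in> carrier M"
    show "fsum M (\<lambda>i. x i (m \<oplus> n)) = fsum M (\<lambda>i. x i m) \<oplus> fsum M (\<lambda>i. x i n)"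
      using fsum_add[OF summable_familyD(3)[OF x m] summable_familyD(3)[OF x n]]
      by (simp add: End_add xE m n) }
  fix r assume r: "r \<in> carrier R"
  have "fsum M (\<lambda>i. ract M (x i m) r) = ract M (fsum M (\<lambda>i. x i m)) r"
    by (rule fsum_additive[OF is_abelian_group]) (use r m ract_add summable_familyD(3)[OF x] in auto)
  then show "fsum M (\<lambda>i. x i (ract M m r)) = ract M (fsum M (\<lambda>i. x i m)) r"
    by (simp add: End_ract xE m r)
qed

lemma fsum_End:
  assumes "a \<in> carrier E" "fin_family M c"
  shows "fsum M (\<lambda>i. a (c i)) = a (fsum M c)"
  by (rule fsum_additive[OF is_abelian_group]) (use assms End_add in auto)

lemma esum_mult_left:
  assumes x: "summable_family x" and a: "a \<in> carrier E"
  shows "a \<otimes>\<^bsub>E\<^esub> esum x = esum (\<lambda>i. a \<otimes>\<^bsub>E\<^esub> x i)"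
proof (rule End_eqI)
  show "esum (\<lambda>i. a \<otimes>\<^bsub>E\<^esub> x i) \<in> carrier E"
    using x a by (intro esum_closed summable_family_mult_left) auto
  fix m assume m: "m \<in> carrier M"
  show "(a \<otimes>\<^bsub>E\<^esub> esum x) m = esum (\<lambda>i. a \<otimes>\<^bsub>E\<^esub> x i) m"
    using fsum_End[OF a summable_familyD(3)[OF x m]] m by (simp add: esum_app)
qed (use esum_closed[OF x] a in simp)

lemma esum_mult_right:
  assumes x: "summable_family x" and b: "b \<in> carrier E"
  shows "esum x \<otimes>\<^bsub>E\<^esub> b = esum (\<lambda>i. x i \<otimes>\<^bsub>E\<^esub> b)"
proof (rule End_eqI)
  show "esum (\<lambda>i. x i \<otimes>\<^bsub>E\<^esub> b) \<in> carrier E"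
    using x b by (intro esum_closed summable_family_mult_right) auto
  fix m assume m: "m \<in> carrier M"
  show "(esum x \<otimes>\<^bsub>E\<^esub> b) m = esum (\<lambda>i. x i \<otimes>\<^bsub>E\<^esub> b) m"
    using m b by (simp add: esum_app)
qed (use esum_closed[OF x] b in simp)

lemma esum_insert:
  assumes x: "summable_family x" and j: "j \<notin> K"
  shows "esum (restr (insert j K) x) = x j \<oplus>\<^bsub>E\<^esub> esum (restr K x)"
proof (rule End_eqI)
  show "esum (restr (insert j K) x) \<in> carrier E" "x j \<oplus>\<^bsub>E\<^esub> esum (restr K x) \<in> carrier E"
    using esum_closed[OF summable_family_restr[OF x]] summable_familyD(1)[OF x] by auto
  fix m assume m: "m \<in> carrier M"
  have xm: "x j m \<in> carrier M" using summable_familyD(1)[OF x] m by simp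
  have "fin_family M (\<lambda>i. if i = j then x j m else \<zero>)"
    by (rule fin_familyI'[of _ "{j}"]) (use xm in auto)
  from fsum_add[OF this summable_familyD(3)[OF summable_family_restr[OF x] m], of K]
  have "fsum M (\<lambda>i. (if i = j then x j m else \<zero>) \<oplus> restr K x i m) = x j m \<oplus> fsum M (\<lambda>i. restr K x i m)"
    using xm by (simp add: fsum_single)
  moreover have "(\<lambda>i. (if i = j then x j m else \<zero>) \<oplus> restr K x i m) = (\<lambda>i. restr (insert j K) x i m)"
    using j m xm summable_familyD(1)[OF x] by (auto simp: restr_def fun_eq_iff)
  ultimately show "esum (restr (insert j K) x) m = (x j \<oplus>\<^bsub>E\<^esub> esum (restr K x)) m"
    using m by (simp add: esum_app)
qed

section \<open>Submodules, direct summands and the use of \<open>(C\<^sub>2)\<close>\<close>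

lemma submodule_image:
  assumes f: "f \<in> carrier E" and S: "submodule R M S"
  shows "submodule R M (f ` S)"
  unfolding submodule_iff
proof (intro conjI ballI)
  have SM: "x \<in> carrier M" if "x \<in> S" for x using S that by (auto simp: submodule_iff)
  show "f ` S \<subseteq> carrier M" using f SM by auto
  show "\<zero> \<in> f ` S" using f S by (intro image_eqI[of _ _ \<zero>]) (auto simp: submodule_iff)
  fix y assume "y \<in> f ` S"
  then obtain x where x: "x \<in> S" "y = f x" by blast
  { fix y' assume "y' \<in> f ` S"
    then obtain x' where x': "x' \<in> S" "y' = f x'" by blast
    show "y \<oplus> y' \<in> f ` S" using f S x x' SM
      by (intro image_eqI[of _ _ "x \<oplus> x'"]) (auto simp: submodule_iff End_add) }
  show "\<ominus> y \<in> f ` S" using f S x SM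
    by (intro image_eqI[of _ _ "\<ominus> x"]) (auto simp: submodule_iff End_uminus)
  fix r assume "r \<in> carrier R" then show "ract M y r \<in> f ` S" using f S x SM
    by (intro image_eqI[of _ _ "ract M x r"]) (auto simp: submodule_iff End_ract)
qed

lemma submodule_carrier: "submodule R M (carrier M)"
  by (simp add: submodule_iff)

lemma submodule_kernel:
  assumes f: "f \<in> carrier E"
  shows "submodule R M {m \<in> carrier M. f m = \<zero>}"
  using f by (auto simp: submodule_iff End_add End_uminus End_ract ract_zero_minus)

lemma direct_summand_image:
  assumes f: "f \<in> carrier E" "f \<otimes>\<^bsub>E\<^esub> f = f"
  shows "direct_summand R M (f ` carrier M)"
proof -
  let ?S = "f ` carrier M" and ?T = "{m \<in> carrier M. f m = \<zero>}"
  have ff: "f (f m) = f m" if "m \<in> carrier M" for m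
    using f(2) End_app(1)[OF that, of f f] by simp
  have S: "submodule R M ?S" using submodule_image[OF f(1) submodule_carrier] .
  have T: "submodule R M ?T" using submodule_kernel[OF f(1)] .
  have "internal_dsum M UNIV (\<lambda>b. if b then ?S else ?T)"
  proof (subst internal_dsum_iff[OF is_abelian_group], goal_cases)
    case 1 then show ?case using S T by (auto simp: submodule_iff)
  next
    case 2 then show ?case using S T by (auto simp: submodule_iff)
  next
    case 3
    show ?case
    proof (intro conjI ballI allI impI)
      fix a assume a: "a \<in> carrier M"
      let ?c = "\<lambda>b. if b then f a else a \<ominus> f a"
      have "family_in M UNIV (\<lambda>b. if b then ?S else ?T) ?c"
        using a f(1) ff by (auto simp: family_in_def End_minus r_neg minus_eq[of "f a"])
      moreover have "fsum M ?c = a"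
        using a f(1) a_comm[of "f a" "a \<ominus> f a"] by (simp add: fsum_bool minus_eq a_assoc l_neg)
      ultimately show "\<exists>c. family_in M UNIV (\<lambda>b. if b then ?S else ?T) c \<and> fsum M c = a" by blast
    next
      fix c i assume c: "family_in M UNIV (\<lambda>b. if b then ?S else ?T) c \<and> fsum M c = \<zero>"
      then have "\<forall>b. c b \<in> (if b then ?S else ?T)" by (simp add: family_in_def)
      then have "c True \<in> ?S" "c False \<in> ?T" by (metis (full_types))+
      then obtain n where n: "n \<in> carrier M" "c True = f n" and cF: "c False \<in> carrier M" "f (c False) = \<zero>" by auto
      have 0: "f n \<oplus> c False = \<zero>" using c n cF f(1) by (simp add: fsum_bool)
      then have "f (f n \<oplus> c False) = \<zero>" using f by simp
      then have "f n = \<zero>" using n cF f(1) ff by (simp add: End_add)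
      then show "c i = \<zero>" using 0 n cF by (cases i) auto
    qed
  qed
  then show ?thesis using S T unfolding direct_summand_def by blast
qed

lemma direct_summand_projection:
  assumes "direct_summand R M S"
  shows "\<exists>p\<in>carrier E. (\<forall>m\<in>carrier M. p m \<in> S) \<and> (\<forall>s\<in>S. p s = s)"
proof -
  obtain T where S: "submodule R M S" and T: "submodule R M T"
    and ds: "internal_dsum M (UNIV :: bool set) (\<lambda>b. if b then S else T)"
    using assms by (auto simp: direct_summand_def)
  have sub: "submodule R M (if b then S else T)" for b using S T by simp
  obtain p where p: "\<And>i. p i \<in> carrier E"
    "\<And>m. m \<in> carrier M \<Longrightarrow> family_in M UNIV (\<lambda>b. if b then S else T) (\<lambda>i. p i m)"
    "\<And>c j. family_in M UNIV (\<lambda>b. if b then S else T) c \<Longrightarrow> p j (fsum M c) = c j"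
    by (rule internal_dsum_projections[OF sub ds]) (rule that)
  have "p True s = s" if s: "s \<in> S" for s
  proof -
    let ?c = "\<lambda>b. if b then s else \<zero>"
    have "s \<in> carrier M" using s S by (auto simp: submodule_iff)
    moreover have "family_in M UNIV (\<lambda>b. if b then S else T) ?c"
      using s T by (auto simp: family_in_def submodule_iff)
    ultimately show ?thesis using p(3)[of ?c True] by (simp add: fsum_bool)
  qed
  moreover have "p True m \<in> S" if "m \<in> carrier M" for m
    using p(2)[OF that] unfolding family_in_def by (metis (full_types) UNIV_I)
  ultimately show ?thesis using p(1) by blast
qed

text \<open>\<open>x\<close> maps the summand \<open>f M\<close> isomorphically onto its image,
  which (C2) makes a summand as well. So the inverse of this isomorphism, preceded by a projection
  onto the image, is defined on all of \<open>M\<close>; this is \<open>r\<close>.\<close>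

lemma C2_left_inverse:
  assumes C2: "C2 R M" and f: "f \<in> carrier E" "f \<otimes>\<^bsub>E\<^esub> f = f" and x: "x \<in> carrier E"
    and inj: "\<And>m. m \<in> carrier M \<Longrightarrow> x (f m) = \<zero> \<Longrightarrow> f m = \<zero>"
  shows "\<exists>r\<in>carrier E. r \<otimes>\<^bsub>E\<^esub> x \<otimes>\<^bsub>E\<^esub> f = f"
proof -
  let ?T = "f ` carrier M" let ?S = "x ` ?T"
  have T: "submodule R M ?T" using submodule_image[OF f(1) submodule_carrier] .
  then have S: "submodule R M ?S" using submodule_image[OF x] by blast
  have TM: "t \<in> carrier M" if "t \<in> ?T" for t using that f by auto
  have bij: "bij_betw x ?T ?S"
    unfolding bij_betw_def
  proof
    show "inj_on x ?T"
    proof (rule inj_onI)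
      fix s t assume s: "s \<in> ?T" and t: "t \<in> ?T" and eq: "x s = x t"
      have "s \<oplus> \<ominus> t \<in> ?T" using T s t unfolding submodule_iff by blast
      moreover have "x (s \<oplus> \<ominus> t) = \<zero>"
        using x eq TM s t by (simp add: End_add End_uminus r_neg del: image_iff)
      ultimately have "s \<oplus> \<ominus> t = \<zero>" using inj by auto
      then show "s = t" using minus_equality[of s "\<ominus> t"] TM[OF s] TM[OF t] by simp
    qed
  qed simp
  define g where "g = inv_into ?T x"
  have g: "bij_betw g ?S ?T" using bij_betw_inv_into[OF bij] by (simp add: g_def)
  have gx: "g (x t) = t" if "t \<in> ?T" for t
    unfolding g_def using bij that by (meson bij_betw_inv_into_left)
  have gadd: "g (u \<oplus> v) = g u \<oplus> g v" if uv: "u \<in> ?S" "v \<in> ?S" for u v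
  proof -
    obtain s t where st: "s \<in> ?T" "u = x s" "t \<in> ?T" "v = x t" using uv by blast
    then have "u \<oplus> v = x (s \<oplus> t)" using x TM by (simp add: End_add)
    moreover have "s \<oplus> t \<in> ?T" using T st unfolding submodule_iff by blast
    ultimately show ?thesis using gx st by metis
  qed
  have gract: "g (ract M u r) = ract M (g u) r" if u: "u \<in> ?S" and r: "r \<in> carrier R" for u r
  proof -
    obtain s where st: "s \<in> ?T" "u = x s" using u by blast
    then have "ract M u r = x (ract M s r)" using x TM r by (simp add: End_ract)
    moreover have "ract M s r \<in> ?T" using T st r unfolding submodule_iff by blast
    ultimately show ?thesis using gx st by metis
  qed
  have gcl: "g u \<in> carrier M" if "u \<in> ?S" for u using g TM that by (meson bij_betwE)
  have "module_hom_on R M ?S M g"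
    unfolding module_hom_on_def using gcl gadd gract by blast
  then have "mod_iso R M ?S M ?T" using g unfolding mod_iso_def by blast
  moreover note S direct_summand_image[OF f]
  ultimately have ds: "direct_summand R M ?S" using C2[unfolded C2_def, rule_format, of ?S ?T] by simp
  obtain p where p: "p \<in> carrier E" "\<forall>m\<in>carrier M. p m \<in> ?S" "\<forall>s\<in>?S. p s = s"
    using direct_summand_projection[OF ds] by (elim bexE conjE)
  define r where "r = (\<lambda>m\<in>carrier M. g (p m))"
  have r: "r \<in> carrier E" unfolding r_def
    by (rule restrict_in_End) (use p(1) bspec[OF p(2)] gcl gadd gract in \<open>simp_all add: End_add End_ract del: image_iff\<close>)
  have "r \<otimes>\<^bsub>E\<^esub> x \<otimes>\<^bsub>E\<^esub> f = f"
  proof (rule End_eqI)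
    fix m assume m: "m \<in> carrier M"
    then have fm: "f m \<in> ?T" by blast
    then have "p (x (f m)) = x (f m)" by (intro bspec[OF p(3)] imageI m)
    then have "g (p (x (f m))) = f m" using gx[OF fm] by simp
    then show "(r \<otimes>\<^bsub>E\<^esub> x \<otimes>\<^bsub>E\<^esub> f) m = f m" using m f x by (simp add: r_def)
  qed (use r x f in auto)
  then show ?thesis using r by blast
qed

end

section \<open>The radical acting on vectors and its closure under infinite sums\<close>

locale semi_pi_mod = M?: right_mod R M + semi_pi_hom "End R M" S h
  for R :: "('k, 'c) ring_scheme" and M :: "('k, 'a, 'd) rmod_scheme" (structure)
  and S :: "('b, 'e) ring_scheme" and h
begin

text \<open>\<open>1 - j\<close> is a unit and kills \<open>m\<close>.\<close>

lemma hom_zero_no_fixpoint: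
  assumes j: "j \<in> carrier E" "h j = \<zero>\<^bsub>S\<^esub>" and m: "m \<in> carrier M" "j m = m"
  shows "m = \<zero>"
proof -
  have "\<one>\<^bsub>E\<^esub> \<ominus>\<^bsub>E\<^esub> j \<in> Units E" using E.Units_one_minus_jacobson j kernel_iff by blast
  then obtain v where v: "v \<in> carrier E" "v \<otimes>\<^bsub>E\<^esub> (\<one>\<^bsub>E\<^esub> \<ominus>\<^bsub>E\<^esub> j) = \<one>\<^bsub>E\<^esub>" using E.Units_l_inv_ex by blast
  have "m = (v \<otimes>\<^bsub>E\<^esub> (\<one>\<^bsub>E\<^esub> \<ominus>\<^bsub>E\<^esub> j)) m" using v(2) m by simp
  also have "\<dots> = v (m \<ominus> j m)" using j m by simp
  also have "\<dots> = \<zero>" using m v by (simp add: M.minus_eq M.r_neg)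
  finally show ?thesis .
qed

text \<open>The finite sum is specified by its values, since it is to be compared with
  \<open>esum\<close> at a single vector.\<close>

lemma finsum_hom_zero:
  assumes "finite F" "\<And>i. z i \<in> carrier E" "\<And>i. h (z i) = \<zero>\<^bsub>S\<^esub>"
  shows "\<exists>j\<in>carrier E. h j = \<zero>\<^bsub>S\<^esub> \<and> (\<forall>m\<in>carrier M. j m = finsum M (\<lambda>i. z i m) F)"
  using assms(1)
proof induction
  case empty
  show ?case by (intro bexI[of _ "\<zero>\<^bsub>E\<^esub>"]) auto
next
  case (insert i F)
  then obtain j where j: "j \<in> carrier E" "h j = \<zero>\<^bsub>S\<^esub>" "\<forall>m\<in>carrier M. j m = finsum M (\<lambda>i. z i m) F" by blast
  show ?case using insert j assms(2,3)
    by (intro bexI[of _ "z i \<oplus>\<^bsub>E\<^esub> j"]) (auto simp: Pi_def)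
qed

text \<open>The Jacobson radical is closed in the finite topology: otherwise some nonzero idempotent
  \<open>e\<close> is congruent to \<open>esum z \<cdot> t\<close>, and on a given vector in its range \<open>e\<close> acts like an element
  of the radical.\<close>

lemma esum_hom_zero:
  assumes z: "summable_family z" and hz: "\<And>i. h (z i) = \<zero>\<^bsub>S\<^esub>"
  shows "h (esum z) = \<zero>\<^bsub>S\<^esub>"
proof (rule ccontr)
  note zE = summable_familyD(1)[OF z]
  have s: "esum z \<in> carrier E" using esum_closed[OF z] .
  assume "h (esum z) \<noteq> \<zero>\<^bsub>S\<^esub>"
  then obtain t e where t: "t \<in> carrier E" and e: "e \<in> carrier E" "e \<otimes>\<^bsub>E\<^esub> e = e" "h e = h (esum z \<otimes>\<^bsub>E\<^esub> t)"
    and nz: "h e \<noteq> \<zero>\<^bsub>S\<^esub>"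
    using nonzero_idempotent[OF s] by blast
  have "e m = \<zero>" if m: "m \<in> carrier M" for m
  proof -
    define m' where "m' = e m"
    have m': "m' \<in> carrier M" "e m' = m'" using e m End_app(1)[OF m, of e e] by (auto simp: m'_def)
    let ?F = "{i. z i (t m') \<noteq> \<zero>}"
    have tm': "t m' \<in> carrier M" using t m' by simp
    have F: "finite ?F" using summable_familyD(2)[OF z tm'] .
    obtain j where j: "j \<in> carrier E" "h j = \<zero>\<^bsub>S\<^esub>" "\<And>m. m \<in> carrier M \<Longrightarrow> j m = finsum M (\<lambda>i. z i m) ?F"
      using finsum_hom_zero[of ?F z] F zE hz by blast
    \<comment> \<open>At \<open>t m'\<close> the infinite sum agrees with its finite part
      \<open>j\<close>. Hence \<open>j t + (e - esum z t)\<close>, both of whose terms are mapped to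
      zero by \<open>h\<close>, fixes \<open>m'\<close>.\<close>
    have "esum z (t m') = j (t m')" using j(3)[OF tm'] by (simp add: esum_app tm' fsum_def)
    then have "(j \<otimes>\<^bsub>E\<^esub> t \<oplus>\<^bsub>E\<^esub> (e \<ominus>\<^bsub>E\<^esub> esum z \<otimes>\<^bsub>E\<^esub> t)) m' = j (t m') \<oplus> (m' \<ominus> j (t m'))"
      using m' e t s j(1) by simp
    also have "\<dots> = m'" using j(1) tm' m' M.a_comm[of "j (t m')" "m' \<ominus> j (t m')"] by (simp add: M.minus_eq M.a_assoc M.l_neg)
    finally have "(j \<otimes>\<^bsub>E\<^esub> t \<oplus>\<^bsub>E\<^esub> (e \<ominus>\<^bsub>E\<^esub> esum z \<otimes>\<^bsub>E\<^esub> t)) m' = m'" .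
    moreover have "h (j \<otimes>\<^bsub>E\<^esub> t \<oplus>\<^bsub>E\<^esub> (e \<ominus>\<^bsub>E\<^esub> esum z \<otimes>\<^bsub>E\<^esub> t)) = \<zero>\<^bsub>S\<^esub>"
      using j t e s by (simp add: S.minus_eq S.r_neg)
    moreover have "j \<otimes>\<^bsub>E\<^esub> t \<oplus>\<^bsub>E\<^esub> (e \<ominus>\<^bsub>E\<^esub> esum z \<otimes>\<^bsub>E\<^esub> t) \<in> carrier E" using j(1) t e(1) s by simp
    ultimately show ?thesis using hom_zero_no_fixpoint m'(1) unfolding m'_def by blast
  qed
  then have "e = \<zero>\<^bsub>E\<^esub>" using e by (intro End_eqI) auto
  then show False using nz by simp
qed

end

section \<open>Transfinite construction of the idempotents\<close>

locale partition_of_one = semi_pi_mod R M S h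
  for R :: "('k, 'c) ring_scheme" and M :: "('k, 'a, 'd) rmod_scheme" (structure)
  and S :: "('b, 'e) ring_scheme" and h +
  fixes x :: "'i \<Rightarrow> 'a \<Rightarrow> 'a" and lt :: "'i \<Rightarrow> 'i \<Rightarrow> bool"
  assumes C2: "C2 R M" and summable: "summable_family x" and sum_one: "esum x = \<one>\<^bsub>End R M\<^esub>"
    and wf_lt: "wf {(i, j). lt i j}" and trans_lt: "lt i j \<Longrightarrow> lt j k \<Longrightarrow> lt i k"
    and total_lt: "i = j \<or> lt i j \<or> lt j i"
begin

lemma lt_irrefl: "\<not> lt i i"
  using wf_not_refl[OF wf_lt, of i] by simp

lemma finite_max:
  assumes "finite F" "F \<noteq> {}" shows "\<exists>j\<in>F. \<forall>k\<in>F. k = j \<or> lt k j"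
  using assms
proof (induction F rule: finite_ne_induct)
  case (insert i F)
  then obtain j where j: "j \<in> F" "\<forall>k\<in>F. k = j \<or> lt k j" by blast
  have "j \<noteq> i" using j(1) insert.hyps by blast
  then consider "lt i j" | "lt j i" using total_lt by blast
  then show ?case
  proof cases
    case 1 then show ?thesis using j by blast
  next
    case 2
    then have "\<forall>k\<in>insert i F. k = i \<or> lt k i" using j trans_lt by (metis insert_iff)
    then show ?thesis by blast
  qed
qed simp

lemma xE [simp]: "x i \<in> carrier E"
  using summable_familyD(1)[OF summable] .

definition xsum :: "'i set \<Rightarrow> 'a \<Rightarrow> 'a" where "xsum K = esum (restr K x)"

lemma xsum_closed [simp]: "xsum K \<in> carrier E"
  unfolding xsum_def by (intro esum_closed summable_family_restr summable)

lemma xsum_app: "m \<in> carrier M \<Longrightarrow> xsum K m = fsum M (\<lambda>i. if i \<in> K then x i m else \<zero>)"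
  by (simp add: xsum_def esum_app restr_def if_distribR cong: if_cong)

text \<open>\<open>stage e j r\<close> says that \<open>r\<close> may be chosen as the idempotent \<open>e\<^sub>j\<close>. The last clause is the
  invariant that survives limits: whatever \<open>e\<^sub>k\<close> (\<open>k \<le> j\<close>) annihilate modulo the radical, the
  remaining sum \<open>\<Sum>\<^sub>k\<^sub>>\<^sub>j x\<^sub>k\<close> can be inverted on from the left modulo the radical.\<close>

definition stage :: "('i \<Rightarrow> 'a \<Rightarrow> 'a) \<Rightarrow> 'i \<Rightarrow> ('a \<Rightarrow> 'a) \<Rightarrow> bool" where
  "stage e j r \<longleftrightarrow> (\<exists>a\<in>carrier E. r = a \<otimes>\<^bsub>E\<^esub> x j) \<and> r \<otimes>\<^bsub>E\<^esub> r = r \<and>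
    (\<forall>k. lt k j \<longrightarrow> h (e k \<otimes>\<^bsub>E\<^esub> r) = \<zero>\<^bsub>S\<^esub>) \<and>
    (\<forall>y\<in>carrier E. (\<forall>k. lt k j \<longrightarrow> h (e k \<otimes>\<^bsub>E\<^esub> y) = \<zero>\<^bsub>S\<^esub>) \<longrightarrow> h (r \<otimes>\<^bsub>E\<^esub> y) = \<zero>\<^bsub>S\<^esub> \<longrightarrow>
      (\<exists>q\<in>carrier E. h y = h (q \<otimes>\<^bsub>E\<^esub> xsum {k. lt j k} \<otimes>\<^bsub>E\<^esub> y)))"

lemma stage_closed: "stage e j r \<Longrightarrow> r \<in> carrier E"
  by (auto simp: stage_def)

definition stages :: "'i set \<Rightarrow> ('i \<Rightarrow> 'a \<Rightarrow> 'a) \<Rightarrow> bool" where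
  "stages D e \<longleftrightarrow> (\<forall>k\<in>D. stage e k (e k) \<and> (\<forall>l. lt l k \<longrightarrow> l \<in> D))"

lemma stagesD:
  assumes "stages D e" "k \<in> D"
  shows "stage e k (e k)" "e k \<in> carrier E" "lt l k \<Longrightarrow> l \<in> D"
  using assms stage_closed unfolding stages_def by blast+

text \<open>Left multiples of the \<open>x k\<close> vanish wherever the \<open>x k\<close> do; this
  is one reason for requiring \<open>e k\<close> to be a multiple of \<open>x k\<close>.\<close>

lemma stage_summable:
  assumes "stages D e"
  shows "summable_family (restr D e)"
proof -
  have "\<forall>k. \<exists>a\<in>carrier E. restr D e k = a \<otimes>\<^bsub>E\<^esub> x k"
  proof
    fix k
    show "\<exists>a\<in>carrier E. restr D e k = a \<otimes>\<^bsub>E\<^esub> x k"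
    proof (cases "k \<in> D")
      case True then show ?thesis using stagesD(1)[OF assms True] by (auto simp: restr_def stage_def)
    next
      case False then show ?thesis by (intro bexI[of _ "\<zero>\<^bsub>E\<^esub>"]) (auto simp: restr_def)
    qed
  qed
  then obtain a where a: "\<And>k. a k \<in> carrier E" "\<And>k. restr D e k = a k \<otimes>\<^bsub>E\<^esub> x k" by metis
  have "restr D e = (\<lambda>k. a k \<otimes>\<^bsub>E\<^esub> x k)" using a(2) by blast
  then show ?thesis using summable_family_mult_left[OF summable a(1)] by simp
qed

text \<open>Modulo the radical the matrix \<open>e k \<otimes> e l\<close> is lower unitriangular, so the sum \<open>u\<close> of the
  \<open>e k\<close> has the same right annihilator as its square.\<close>

lemma triangular:
  assumes st: "stages D e" and y: "y \<in> carrier E"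
  defines "u \<equiv> esum (restr D e)"
  shows "(\<forall>k\<in>D. h (e k \<otimes>\<^bsub>E\<^esub> y) = \<zero>\<^bsub>S\<^esub>) \<Longrightarrow> h (u \<otimes>\<^bsub>E\<^esub> y) = \<zero>\<^bsub>S\<^esub>"
    and "(\<forall>k\<in>D. h (e k \<otimes>\<^bsub>E\<^esub> (u \<otimes>\<^bsub>E\<^esub> y)) = \<zero>\<^bsub>S\<^esub>) \<Longrightarrow> k \<in> D \<Longrightarrow> h (e k \<otimes>\<^bsub>E\<^esub> y) = \<zero>\<^bsub>S\<^esub>"
proof -
  have sum: "summable_family (restr D e)" using stage_summable st .
  { assume z: "\<forall>k\<in>D. h (e k \<otimes>\<^bsub>E\<^esub> y) = \<zero>\<^bsub>S\<^esub>"
    have "h (restr D e k \<otimes>\<^bsub>E\<^esub> y) = \<zero>\<^bsub>S\<^esub>" for k using z y by (simp add: restr_def)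
    then have "h (esum (\<lambda>k. restr D e k \<otimes>\<^bsub>E\<^esub> y)) = \<zero>\<^bsub>S\<^esub>"
      using esum_hom_zero[OF summable_family_mult_right[OF sum y]] by blast
    then show "h (u \<otimes>\<^bsub>E\<^esub> y) = \<zero>\<^bsub>S\<^esub>" by (simp add: u_def esum_mult_right[OF sum y]) }
  assume z: "\<forall>k\<in>D. h (e k \<otimes>\<^bsub>E\<^esub> (u \<otimes>\<^bsub>E\<^esub> y)) = \<zero>\<^bsub>S\<^esub>"
  show "k \<in> D \<Longrightarrow> h (e k \<otimes>\<^bsub>E\<^esub> y) = \<zero>\<^bsub>S\<^esub>"
  proof (induction k rule: wf_induct_rule[OF wf_lt])
    case (1 k)
    have ek: "e k \<in> carrier E" "e k \<otimes>\<^bsub>E\<^esub> e k = e k"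
      using stagesD[OF st 1(2)] unfolding stage_def by blast+
    have kk: "insert k (- {k}) = UNIV" by blast
    define z where "z i = e k \<otimes>\<^bsub>E\<^esub> (restr D e i \<otimes>\<^bsub>E\<^esub> y)" for i
    have sy: "summable_family (\<lambda>i. restr D e i \<otimes>\<^bsub>E\<^esub> y)" using summable_family_mult_right[OF sum y] .
    have sz: "summable_family z" unfolding z_def using summable_family_mult_left[OF sy ek(1)] .
    have "e k \<otimes>\<^bsub>E\<^esub> (u \<otimes>\<^bsub>E\<^esub> y) = esum z"
      by (simp add: u_def z_def[abs_def] esum_mult_right[OF sum y] esum_mult_left[OF sy ek(1)])
    also have "\<dots> = z k \<oplus>\<^bsub>E\<^esub> esum (restr (- {k}) z)"
      using esum_insert[OF sz, of k "- {k}"] kk by simp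
    finally have split: "e k \<otimes>\<^bsub>E\<^esub> (u \<otimes>\<^bsub>E\<^esub> y) = z k \<oplus>\<^bsub>E\<^esub> esum (restr (- {k}) z)" .
    \<comment> \<open>Only the diagonal term survives: for \<open>i\<close> before \<open>k\<close>
      the induction hypothesis kills \<open>e i y\<close>, and for \<open>i\<close> after
      \<open>k\<close> the product \<open>e k e i\<close> is radical by the choice of
      \<open>e i\<close>.\<close>
    have "h (restr (- {k}) z i) = \<zero>\<^bsub>S\<^esub>" for i
    proof (cases "i \<noteq> k \<and> i \<in> D")
      case True
      have ei: "e i \<in> carrier E" using stagesD(2)[OF st] True by blast
      have zi: "z i = e k \<otimes>\<^bsub>E\<^esub> (e i \<otimes>\<^bsub>E\<^esub> y)" "z i = (e k \<otimes>\<^bsub>E\<^esub> e i) \<otimes>\<^bsub>E\<^esub> y"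
        using True ek(1) ei y by (simp_all add: z_def restr_def E.m_assoc)
      consider "lt i k" | "lt k i" using True total_lt by blast
      then have "h (z i) = \<zero>\<^bsub>S\<^esub>"
      proof cases
        case 1
        then have "h (e i \<otimes>\<^bsub>E\<^esub> y) = \<zero>\<^bsub>S\<^esub>" using "1.IH" True by simp
        then show ?thesis unfolding zi(1) using ek(1) ei y hom_mult[of "e k" "e i \<otimes>\<^bsub>E\<^esub> y"] by simp
      next
        case 2
        then have "h (e k \<otimes>\<^bsub>E\<^esub> e i) = \<zero>\<^bsub>S\<^esub>" using stagesD(1)[OF st, of i] True unfolding stage_def by blast
        then show ?thesis unfolding zi(2) using ek(1) ei y hom_mult[of "e k \<otimes>\<^bsub>E\<^esub> e i" y] by simp
      qed
      then show ?thesis using True by (simp add: restr_def)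
    next
      case False
      then show ?thesis using ek(1) y by (auto simp: restr_def z_def)
    qed
    then have "h (esum (restr (- {k}) z)) = \<zero>\<^bsub>S\<^esub>"
      by (intro esum_hom_zero summable_family_restr sz)
    moreover have "z k = e k \<otimes>\<^bsub>E\<^esub> y" using ek y \<open>k \<in> D\<close> by (simp add: z_def restr_def flip: E.m_assoc)
    ultimately have "h (e k \<otimes>\<^bsub>E\<^esub> (u \<otimes>\<^bsub>E\<^esub> y)) = h (e k \<otimes>\<^bsub>E\<^esub> y) \<oplus>\<^bsub>S\<^esub> \<zero>\<^bsub>S\<^esub>"
      unfolding split using ek(1) y esum_closed[OF summable_family_restr[OF sz], of "- {k}"]
      by simp
    then show ?case using z \<open>k \<in> D\<close> ek(1) y by simp
  qed
qed

text \<open>Modulo the radical, \<open>f\<close> projects onto what all \<open>e k\<close> with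
  \<open>k\<close> in \<open>D\<close> annihilate. An arbitrary initial segment \<open>D\<close> is
  allowed, so that the same result serves the indices below some \<open>j\<close> and, at the end,
  all indices.\<close>

lemma residual_idempotent:
  assumes st: "stages D e"
  obtains f where "f \<in> carrier E" "f \<otimes>\<^bsub>E\<^esub> f = f" "\<forall>k\<in>D. h (e k \<otimes>\<^bsub>E\<^esub> f) = \<zero>\<^bsub>S\<^esub>"
    "\<forall>y\<in>carrier E. (\<forall>k\<in>D. h (e k \<otimes>\<^bsub>E\<^esub> y) = \<zero>\<^bsub>S\<^esub>) \<longrightarrow> h (f \<otimes>\<^bsub>E\<^esub> y) = h y"
    "\<exists>w\<in>carrier E. h (\<one>\<^bsub>E\<^esub> \<ominus>\<^bsub>E\<^esub> f) = h (w \<otimes>\<^bsub>E\<^esub> esum (restr D e))"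
    "\<forall>m\<in>carrier M. xsum (- D) (f m) = \<zero> \<longrightarrow> f m = \<zero>"
proof -
  define u where "u = esum (restr D e)"
  have sum: "summable_family (restr D e)" using stage_summable st .
  have uE: "u \<in> carrier E" unfolding u_def using esum_closed[OF sum] .
  note tri = triangular[OF st, folded u_def]
  have eE: "e k \<in> carrier E" if "k \<in> D" for k using stagesD(2)[OF st that] .
  have eu: "h (e k \<otimes>\<^bsub>E\<^esub> y) = \<zero>\<^bsub>S\<^esub>" if "k \<in> D" "y \<in> carrier E" "h (u \<otimes>\<^bsub>E\<^esub> y) = \<zero>\<^bsub>S\<^esub>" for k y
  proof (rule tri(2)[of y k])
    show "\<forall>k\<in>D. h (e k \<otimes>\<^bsub>E\<^esub> (u \<otimes>\<^bsub>E\<^esub> y)) = \<zero>\<^bsub>S\<^esub>"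
    proof
      fix k assume "k \<in> D"
      then show "h (e k \<otimes>\<^bsub>E\<^esub> (u \<otimes>\<^bsub>E\<^esub> y)) = \<zero>\<^bsub>S\<^esub>"
        using hom_mult[of "e k" "u \<otimes>\<^bsub>E\<^esub> y"] eE uE that by simp
    qed
  qed (use that in auto)
  \<comment> \<open>Through \<open>tri\<close> and \<open>eu\<close>, annihilation by
    \<open>u\<close> modulo the radical is the same as annihilation by all \<open>e k\<close>; this
    lets one of the two factors \<open>u\<close> be cancelled.\<close>
  have "h (u \<otimes>\<^bsub>E\<^esub> y) = \<zero>\<^bsub>S\<^esub>" if y: "y \<in> carrier E" "h (u \<otimes>\<^bsub>E\<^esub> (u \<otimes>\<^bsub>E\<^esub> y)) = \<zero>\<^bsub>S\<^esub>" for y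
  proof (rule tri(1)[OF y(1)])
    have "\<forall>k\<in>D. h (e k \<otimes>\<^bsub>E\<^esub> (u \<otimes>\<^bsub>E\<^esub> y)) = \<zero>\<^bsub>S\<^esub>" using eu[of _ "u \<otimes>\<^bsub>E\<^esub> y"] y uE by simp
    then show "\<forall>k\<in>D. h (e k \<otimes>\<^bsub>E\<^esub> y) = \<zero>\<^bsub>S\<^esub>" using tri(2)[of y] y by blast
  qed
  from regular_lift[OF uE this]
  obtain f w where f: "f \<in> carrier E" "f \<otimes>\<^bsub>E\<^esub> f = f" "h (u \<otimes>\<^bsub>E\<^esub> f) = \<zero>\<^bsub>S\<^esub>" and w: "w \<in> carrier E"
    "h (\<one>\<^bsub>E\<^esub> \<ominus>\<^bsub>E\<^esub> f) = h (w \<otimes>\<^bsub>E\<^esub> u)" by blast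
  have ef: "h (e k \<otimes>\<^bsub>E\<^esub> f) = \<zero>\<^bsub>S\<^esub>" if "k \<in> D" for k using eu f that by blast
  have fy: "h (f \<otimes>\<^bsub>E\<^esub> y) = h y" if y: "y \<in> carrier E" "\<And>k. k \<in> D \<Longrightarrow> h (e k \<otimes>\<^bsub>E\<^esub> y) = \<zero>\<^bsub>S\<^esub>" for y
  proof -
    have "h (u \<otimes>\<^bsub>E\<^esub> y) = \<zero>\<^bsub>S\<^esub>" using tri(1)[of y] y by blast
    then have "h u \<otimes>\<^bsub>S\<^esub> h y = \<zero>\<^bsub>S\<^esub>" using uE y by simp
    moreover have "h y \<ominus>\<^bsub>S\<^esub> h (f \<otimes>\<^bsub>E\<^esub> y) = h (\<one>\<^bsub>E\<^esub> \<ominus>\<^bsub>E\<^esub> f) \<otimes>\<^bsub>S\<^esub> h y"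
      using f(1) y(1) by (simp add: S.l_distr S.minus_eq S.l_minus)
    moreover have "\<dots> = h w \<otimes>\<^bsub>S\<^esub> (h u \<otimes>\<^bsub>S\<^esub> h y)" unfolding w(2) using w(1) uE y(1) by (simp add: S.m_assoc)
    ultimately have "h y \<ominus>\<^bsub>S\<^esub> h (f \<otimes>\<^bsub>E\<^esub> y) = \<zero>\<^bsub>S\<^esub>" using w(1) by simp
    then show ?thesis using f(1) y(1) S.r_right_minus_eq[of "h y" "h (f \<otimes>\<^bsub>E\<^esub> y)"] by simp
  qed
  have inj: "f m = \<zero>" if m: "m \<in> carrier M" and Xm: "xsum (- D) (f m) = \<zero>" for m
  proof -
    define n where "n = f m"
    have n: "n \<in> carrier M" "f n = n" using f m End_app(1)[OF m, of f f] by (auto simp: n_def)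
    \<comment> \<open>If no index of \<open>D\<close> moves \<open>n\<close>, the sum over
      \<open>- D\<close> at \<open>n\<close> is \<open>n\<close> itself. Otherwise no index of
      \<open>D\<close> beyond the largest \<open>j\<close> in \<open>F\<close> moves
      \<open>n\<close>, so at \<open>n\<close> the sum over \<open>- D\<close> agrees with the sum
      beyond \<open>j\<close>, to which the invariant of stage \<open>j\<close> applies.\<close>
    define F where "F = {k. x k n \<noteq> \<zero>} \<inter> D"
    have F: "finite F" unfolding F_def using summable_familyD(2)[OF summable n(1)] by simp
    show ?thesis
    proof (cases "F = {}")
      case True
      have Z: "x i n = \<zero>" if "i \<in> D" for i using True that unfolding F_def by blast
      have "xsum (- D) n = xsum UNIV n" unfolding xsum_app[OF n(1)]
        by (intro arg_cong[where f = "fsum M"] ext) (use Z in auto)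
      also have "\<dots> = n" using n(1) by (simp add: xsum_def sum_one)
      finally show ?thesis using Xm by (simp add: n_def)
    next
      case False
      then obtain j where j: "j \<in> F" "\<forall>k\<in>F. k = j \<or> lt k j" using finite_max[OF F] by blast
      then have jD: "j \<in> D" by (simp add: F_def)
      have "xsum {k. lt j k} n = xsum (- D) n" unfolding xsum_app[OF n(1)]
      proof (intro arg_cong[where f = "fsum M"] ext)
        fix i
        have "i \<notin> D \<Longrightarrow> lt j i" using total_lt[of i j] jD stagesD(3)[OF st jD, of i] by auto
        moreover have "i \<in> D \<Longrightarrow> lt j i \<Longrightarrow> x i n = \<zero>"
          using bspec[OF j(2), of i] lt_irrefl[of j] trans_lt[of j i j] by (auto simp: F_def)
        ultimately show "(if i \<in> {k. lt j k} then x i n else \<zero>) = (if i \<in> - D then x i n else \<zero>)" by auto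
      qed
      then have Xj: "xsum {k. lt j k} n = \<zero>" using Xm by (simp add: n_def)
      have "\<exists>q\<in>carrier E. h f = h (q \<otimes>\<^bsub>E\<^esub> xsum {k. lt j k} \<otimes>\<^bsub>E\<^esub> f)"
      proof -
        have step: "\<forall>y\<in>carrier E. (\<forall>k. lt k j \<longrightarrow> h (e k \<otimes>\<^bsub>E\<^esub> y) = \<zero>\<^bsub>S\<^esub>) \<longrightarrow> h (e j \<otimes>\<^bsub>E\<^esub> y) = \<zero>\<^bsub>S\<^esub> \<longrightarrow>
            (\<exists>q\<in>carrier E. h y = h (q \<otimes>\<^bsub>E\<^esub> xsum {k. lt j k} \<otimes>\<^bsub>E\<^esub> y))"
          using stagesD(1)[OF st jD] unfolding stage_def by (elim conjE)
        show ?thesis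
        proof (rule step[rule_format, OF f(1)])
          show "h (e k \<otimes>\<^bsub>E\<^esub> f) = \<zero>\<^bsub>S\<^esub>" if "lt k j" for k by (rule ef[OF stagesD(3)[OF st jD that]])
          show "h (e j \<otimes>\<^bsub>E\<^esub> f) = \<zero>\<^bsub>S\<^esub>" by (rule ef[OF jD])
        qed
      qed
      then obtain q where q: "q \<in> carrier E" "h f = h (q \<otimes>\<^bsub>E\<^esub> xsum {k. lt j k} \<otimes>\<^bsub>E\<^esub> f)" by blast
      \<comment> \<open>\<open>t\<close> is congruent to \<open>f\<close> but kills
        \<open>n\<close>; so the radical element \<open>f - t\<close> fixes
        \<open>n\<close>.\<close>
      define t where "t = q \<otimes>\<^bsub>E\<^esub> xsum {k. lt j k} \<otimes>\<^bsub>E\<^esub> f"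
      have t: "t \<in> carrier E" "h t = h f" using q f(1) by (simp_all add: t_def)
      have "t n = \<zero>" using n Xj q(1) by (simp add: t_def)
      then have "(f \<ominus>\<^bsub>E\<^esub> t) n = n" using n f(1) t(1) by (simp add: M.minus_eq)
      moreover have "h (f \<ominus>\<^bsub>E\<^esub> t) = \<zero>\<^bsub>S\<^esub>" using f(1) t by (simp add: S.minus_eq S.r_neg)
      moreover have "f \<ominus>\<^bsub>E\<^esub> t \<in> carrier E" using f(1) t(1) by simp
      ultimately show ?thesis using hom_zero_no_fixpoint n(1) unfolding n_def by blast
    qed
  qed
  show thesis
    by (rule that[of f]) (use f(1,2) w ef fy inj in \<open>auto simp: u_def\<close>)
qed

lemma stage_exists:
  assumes st: "\<And>k. lt k j \<Longrightarrow> stage e k (e k)"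
  shows "\<exists>r. stage e j r"
proof -
  define D where "D = {k. lt k j}"
  have stD: "stages D e" using st trans_lt by (auto simp: D_def stages_def)
  obtain f where f: "f \<in> carrier E" "f \<otimes>\<^bsub>E\<^esub> f = f"
    and ef: "\<forall>k\<in>D. h (e k \<otimes>\<^bsub>E\<^esub> f) = \<zero>\<^bsub>S\<^esub>"
    and fy: "\<forall>y\<in>carrier E. (\<forall>k\<in>D. h (e k \<otimes>\<^bsub>E\<^esub> y) = \<zero>\<^bsub>S\<^esub>) \<longrightarrow> h (f \<otimes>\<^bsub>E\<^esub> y) = h y"
    and "\<exists>w\<in>carrier E. h (\<one>\<^bsub>E\<^esub> \<ominus>\<^bsub>E\<^esub> f) = h (w \<otimes>\<^bsub>E\<^esub> esum (restr D e))"
    and inj: "\<forall>m\<in>carrier M. xsum (- D) (f m) = \<zero> \<longrightarrow> f m = \<zero>"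
    by (rule residual_idempotent[OF stD]) (rule that)
  define X' where "X' = xsum {k. lt j k}"
  have X'E: "X' \<in> carrier E" by (simp add: X'_def)
  have "\<not> lt i j \<longleftrightarrow> i = j \<or> lt j i" for i
    using total_lt[of i j] lt_irrefl[of j] trans_lt[of i j i] lt_irrefl[of i] by auto
  then have "- D = insert j {k. lt j k}" unfolding D_def by auto
  then have XD: "xsum (- D) = x j \<oplus>\<^bsub>E\<^esub> X'"
    unfolding xsum_def X'_def using esum_insert[OF summable, of j "{k. lt j k}"] lt_irrefl by simp
  obtain r where r: "r \<in> carrier E" "r \<otimes>\<^bsub>E\<^esub> xsum (- D) \<otimes>\<^bsub>E\<^esub> f = f"
    using C2_left_inverse[OF C2 f xsum_closed] inj by blast
  obtain a q where a: "a \<in> carrier E" and q: "q \<in> carrier E" and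
    id: "(a \<otimes>\<^bsub>E\<^esub> x j) \<otimes>\<^bsub>E\<^esub> (a \<otimes>\<^bsub>E\<^esub> x j) = a \<otimes>\<^bsub>E\<^esub> x j" and
    fa: "h (f \<otimes>\<^bsub>E\<^esub> (a \<otimes>\<^bsub>E\<^esub> x j)) = h (a \<otimes>\<^bsub>E\<^esub> x j)" and
    aq: "h ((a \<otimes>\<^bsub>E\<^esub> x j \<oplus>\<^bsub>E\<^esub> q \<otimes>\<^bsub>E\<^esub> X') \<otimes>\<^bsub>E\<^esub> f) = h f"
    using exchange_lift[OF f r(1) xE X'E, of j] r(2) XD by metis
  define g where "g = a \<otimes>\<^bsub>E\<^esub> x j"
  have g: "g \<in> carrier E" using a by (simp add: g_def)
  have eE: "e k \<in> carrier E" if "lt k j" for k using stage_closed st[OF that] .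
  \<comment> \<open>\<open>g\<close> is congruent to \<open>f g\<close>, and \<open>e k f\<close> is
    already radical.\<close>
  have "h (e k \<otimes>\<^bsub>E\<^esub> g) = \<zero>\<^bsub>S\<^esub>" if k: "lt k j" for k
  proof -
    have "h (e k \<otimes>\<^bsub>E\<^esub> g) = h (e k) \<otimes>\<^bsub>S\<^esub> h (f \<otimes>\<^bsub>E\<^esub> g)" using eE[OF k] g fa by (simp add: g_def[symmetric])
    also have "\<dots> = h (e k \<otimes>\<^bsub>E\<^esub> f) \<otimes>\<^bsub>S\<^esub> h g" using eE[OF k] g f(1) by (simp add: S.m_assoc)
    also have "\<dots> = \<zero>\<^bsub>S\<^esub>" using bspec[OF ef, of k] k g unfolding D_def by simp
    finally show ?thesis .
  qed
  \<comment> \<open>The invariant is passed on: such a \<open>y\<close> is congruent to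
    \<open>f y\<close>, so \<open>(g + q X') f\<close> congruent to \<open>f\<close> gives
    \<open>y\<close> congruent to \<open>g y + q X' y\<close>, where \<open>g y\<close> vanishes
    modulo the radical.\<close>
  moreover have "\<exists>q\<in>carrier E. h y = h (q \<otimes>\<^bsub>E\<^esub> xsum {k. lt j k} \<otimes>\<^bsub>E\<^esub> y)"
    if y: "y \<in> carrier E" "\<forall>k. lt k j \<longrightarrow> h (e k \<otimes>\<^bsub>E\<^esub> y) = \<zero>\<^bsub>S\<^esub>" "h (g \<otimes>\<^bsub>E\<^esub> y) = \<zero>\<^bsub>S\<^esub>" for y
  proof -
    have hy: "h f \<otimes>\<^bsub>S\<^esub> h y = h y" using bspec[OF fy y(1)] y f(1) by (simp add: D_def)
    have "h f \<otimes>\<^bsub>S\<^esub> h y = (h g \<oplus>\<^bsub>S\<^esub> h q \<otimes>\<^bsub>S\<^esub> h X') \<otimes>\<^bsub>S\<^esub> (h f \<otimes>\<^bsub>S\<^esub> h y)"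
    proof -
      have "(h g \<oplus>\<^bsub>S\<^esub> h q \<otimes>\<^bsub>S\<^esub> h X') \<otimes>\<^bsub>S\<^esub> h f = h f"
        using aq[folded g_def] f(1) g q X'E by simp
      moreover have "(h g \<oplus>\<^bsub>S\<^esub> h q \<otimes>\<^bsub>S\<^esub> h X') \<otimes>\<^bsub>S\<^esub> (h f \<otimes>\<^bsub>S\<^esub> h y)
          = ((h g \<oplus>\<^bsub>S\<^esub> h q \<otimes>\<^bsub>S\<^esub> h X') \<otimes>\<^bsub>S\<^esub> h f) \<otimes>\<^bsub>S\<^esub> h y"
        using f(1) g q X'E y(1) by (intro S.m_assoc[symmetric]) auto
      ultimately show ?thesis by simp
    qed
    also have "\<dots> = h (g \<otimes>\<^bsub>E\<^esub> y) \<oplus>\<^bsub>S\<^esub> h (q \<otimes>\<^bsub>E\<^esub> X' \<otimes>\<^bsub>E\<^esub> y)"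
      unfolding hy using f(1) g q X'E y(1) by (simp add: S.l_distr)
    also have "\<dots> = h (q \<otimes>\<^bsub>E\<^esub> X' \<otimes>\<^bsub>E\<^esub> y)" unfolding y(3) using q X'E y(1) by simp
    finally show ?thesis using q hy unfolding X'_def by (intro bexI[of _ q]) auto
  qed
  ultimately have "stage e j g" unfolding stage_def using a id unfolding g_def by blast
  then show ?thesis by blast
qed

lemma triangular_partition:
  assumes df: "dedekind_finite E"
  obtains e a where "\<And>i. a i \<in> carrier E" "\<And>i. e i = a i \<otimes>\<^bsub>E\<^esub> x i" "\<And>i. e i \<otimes>\<^bsub>E\<^esub> e i = e i"
    "\<forall>k l. lt k l \<longrightarrow> h (e k \<otimes>\<^bsub>E\<^esub> e l) = \<zero>\<^bsub>S\<^esub>" "esum e \<in> Units E"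
proof -
  have "\<exists>e. \<forall>j. stage e j (e j)"
  \<comment> \<open>\<open>stage e j\<close> consults \<open>e\<close> only below \<open>j\<close>,
    so the choices can be made by recursion along the well-order.\<close>
  proof (rule dependent_wf_choice[OF wf_lt])
    fix f g :: "'i \<Rightarrow> 'a \<Rightarrow> 'a" and j r assume "\<And>z. (z, j) \<in> {(i, j). lt i j} \<Longrightarrow> f z = g z"
    then show "stage f j r = stage g j r" unfolding stage_def by simp
  next
    fix j f assume "\<And>k. (k, j) \<in> {(i, j). lt i j} \<Longrightarrow> stage f k (f k)"
    then show "\<exists>r. stage f j r" by (intro stage_exists) simp
  qed
  then obtain e where e: "\<And>j. stage e j (e j)" by blast
  then have stU: "stages UNIV e" by (simp add: stages_def)
  have "\<forall>i. \<exists>a\<in>carrier E. e i = a \<otimes>\<^bsub>E\<^esub> x i" using e unfolding stage_def by blast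
  then obtain a where a: "\<And>i. a i \<in> carrier E" "\<And>i. e i = a i \<otimes>\<^bsub>E\<^esub> x i" by metis
  define u where "u = esum e"
  have u: "u \<in> carrier E" using esum_closed[OF stage_summable[OF stU]] by (simp add: u_def)
  obtain f where f: "f \<in> carrier E" "f \<otimes>\<^bsub>E\<^esub> f = f"
    and "\<forall>k\<in>UNIV. h (e k \<otimes>\<^bsub>E\<^esub> f) = \<zero>\<^bsub>S\<^esub>"
    and "\<forall>y\<in>carrier E. (\<forall>k\<in>UNIV. h (e k \<otimes>\<^bsub>E\<^esub> y) = \<zero>\<^bsub>S\<^esub>) \<longrightarrow> h (f \<otimes>\<^bsub>E\<^esub> y) = h y"
    and ex_w: "\<exists>w\<in>carrier E. h (\<one>\<^bsub>E\<^esub> \<ominus>\<^bsub>E\<^esub> f) = h (w \<otimes>\<^bsub>E\<^esub> esum (restr UNIV e))"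
    and inj: "\<forall>m\<in>carrier M. xsum (- UNIV) (f m) = \<zero> \<longrightarrow> f m = \<zero>"
    by (rule residual_idempotent[OF stU]) (rule that)
  obtain w where w: "w \<in> carrier E" "h (\<one>\<^bsub>E\<^esub> \<ominus>\<^bsub>E\<^esub> f) = h (w \<otimes>\<^bsub>E\<^esub> u)"
    using ex_w by (auto simp: u_def)
  have "f m = \<zero>" if "m \<in> carrier M" for m using bspec[OF inj that] xsum_app[of "f m" "{}"] f(1) that by simp
  then have "f = \<zero>\<^bsub>E\<^esub>" using f(1) by (intro End_eqI) auto
  then have "h (w \<otimes>\<^bsub>E\<^esub> u) = \<one>\<^bsub>S\<^esub>" using w u by (simp add: S.minus_eq)
  then have "w \<otimes>\<^bsub>E\<^esub> u \<in> Units E" using Units_if_hom_one w(1) u by simp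
  then obtain v where v: "v \<in> carrier E" "v \<otimes>\<^bsub>E\<^esub> (w \<otimes>\<^bsub>E\<^esub> u) = \<one>\<^bsub>E\<^esub>" using E.Units_l_inv_ex by blast
  then have vw: "(v \<otimes>\<^bsub>E\<^esub> w) \<otimes>\<^bsub>E\<^esub> u = \<one>\<^bsub>E\<^esub>" using w(1) u by (simp add: E.m_assoc)
  moreover have "u \<otimes>\<^bsub>E\<^esub> (v \<otimes>\<^bsub>E\<^esub> w) = \<one>\<^bsub>E\<^esub>"
    using vw df v(1) w(1) u unfolding dedekind_finite_def by simp
  ultimately have "u \<in> Units E" using v(1) w(1) u unfolding Units_def by blast
  moreover have "e i \<otimes>\<^bsub>E\<^esub> e i = e i" "\<forall>k l. lt k l \<longrightarrow> h (e k \<otimes>\<^bsub>E\<^esub> e l) = \<zero>\<^bsub>S\<^esub>" for i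
    using e unfolding stage_def by blast+
  ultimately show thesis using that[of a e] a unfolding u_def by blast
qed

end

section \<open>The exchange property\<close>

text \<open>Triangularity holds only modulo the radical, so \<open>e a\<close> does not kill vectors
  \<open>w\<close> from the ranges of later idempotents. To compare its action on them with a
  radical element, the induction carries one endomorphism \<open>g\<close> that fixes all such sums:
  then \<open>e a w = (e a g) w\<close>, and \<open>e a g\<close> is radical.\<close>

lemma (in partition_of_one) triangular_independent:
  assumes eE: "\<And>i. e i \<in> carrier E" and idem: "\<And>i. e i \<otimes>\<^bsub>E\<^esub> e i = e i"
    and tri: "\<forall>k l. lt k l \<longrightarrow> h (e k \<otimes>\<^bsub>E\<^esub> e l) = \<zero>\<^bsub>S\<^esub>" and "finite F"
  shows "\<exists>g\<in>carrier E. (\<forall>k. (\<forall>i\<in>F. lt k i) \<longrightarrow> h (e k \<otimes>\<^bsub>E\<^esub> g) = \<zero>\<^bsub>S\<^esub>) \<and>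
    (\<forall>v. (\<forall>i\<in>F. v i \<in> carrier M \<and> e i (v i) = v i) \<longrightarrow>
       g (finsum M v F) = finsum M v F \<and> (finsum M v F = \<zero> \<longrightarrow> (\<forall>i\<in>F. v i = \<zero>)))"
  using \<open>finite F\<close>
proof (induction F rule: finite_psubset_induct)
  case (psubset F)
  show ?case
  proof (cases "F = {}")
    case True
    then show ?thesis using eE by (intro bexI[of _ "\<zero>\<^bsub>E\<^esub>"]) auto
  next
    case False
    obtain a where a: "a \<in> F" "\<And>b. lt b a \<Longrightarrow> b \<notin> F"
      using wfE_min[OF wf_lt, of _ F] False by (metis (mono_tags, lifting) case_prodI equals0I mem_Collect_eq)
    \<comment> \<open>The least index is removed, so that \<open>a\<close> precedes all of
      \<open>G\<close> and the hypothesis on \<open>g\<close> covers \<open>e a\<close>.\<close>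
    define G where "G = F - {a}"
    have G: "finite G" "a \<notin> G" "F = insert a G" "G \<subset> F" using a psubset.hyps by (auto simp: G_def)
    have aG: "lt a b" if "b \<in> G" for b using that a total_lt[of a b] by (auto simp: G_def)
    obtain g where g: "g \<in> carrier E" and gk: "\<And>k. (\<forall>i\<in>G. lt k i) \<Longrightarrow> h (e k \<otimes>\<^bsub>E\<^esub> g) = \<zero>\<^bsub>S\<^esub>"
      and gv: "\<And>v. (\<forall>i\<in>G. v i \<in> carrier M \<and> e i (v i) = v i) \<Longrightarrow>
        g (finsum M v G) = finsum M v G \<and> (finsum M v G = \<zero> \<longrightarrow> (\<forall>i\<in>G. v i = \<zero>))"
      using psubset.IH[OF G(4)] by blast
    define j where "j = e a \<otimes>\<^bsub>E\<^esub> g"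
    have jE: "j \<in> carrier E" using eE g by (simp add: j_def)
    have "h j = \<zero>\<^bsub>S\<^esub>" using gk[of a] aG by (simp add: j_def)
    then have "\<one>\<^bsub>E\<^esub> \<ominus>\<^bsub>E\<^esub> j \<in> Units E" using E.Units_one_minus_jacobson jE kernel_iff by blast
    then obtain t where t: "t \<in> carrier E" "t \<otimes>\<^bsub>E\<^esub> (\<one>\<^bsub>E\<^esub> \<ominus>\<^bsub>E\<^esub> j) = \<one>\<^bsub>E\<^esub>" using E.Units_l_inv_ex by blast
    \<comment> \<open>With \<open>z = v a + w\<close> and \<open>w = g w\<close> we have \<open>(1 - e a) z = (1 - j) w\<close>, so \<open>s\<close> recovers \<open>w\<close> from \<open>z\<close>.\<close>
    define s where "s = g \<otimes>\<^bsub>E\<^esub> (t \<otimes>\<^bsub>E\<^esub> (\<one>\<^bsub>E\<^esub> \<ominus>\<^bsub>E\<^esub> e a))"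
    have s: "s \<in> carrier E" using g t eE by (simp add: s_def)
    \<comment> \<open>\<open>s\<close> returns \<open>w\<close>, and \<open>e a (1 - s)\<close>
      returns the remaining \<open>v a\<close>. The leading factors, \<open>g\<close> in
      \<open>s\<close> and \<open>e a\<close> here, keep \<open>e k g'\<close> radical for
      \<open>k\<close> before all of \<open>F\<close>.\<close>
    define g' where "g' = s \<oplus>\<^bsub>E\<^esub> e a \<otimes>\<^bsub>E\<^esub> (\<one>\<^bsub>E\<^esub> \<ominus>\<^bsub>E\<^esub> s)"
    have g': "g' \<in> carrier E" using s eE by (simp add: g'_def)
    have "h (e k \<otimes>\<^bsub>E\<^esub> g') = \<zero>\<^bsub>S\<^esub>" if k: "\<forall>i\<in>F. lt k i" for k
    proof -
      have "h (e k \<otimes>\<^bsub>E\<^esub> g) = \<zero>\<^bsub>S\<^esub>" "h (e k \<otimes>\<^bsub>E\<^esub> e a) = \<zero>\<^bsub>S\<^esub>" using gk tri k G by auto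
      moreover have "e k \<otimes>\<^bsub>E\<^esub> g' = (e k \<otimes>\<^bsub>E\<^esub> g) \<otimes>\<^bsub>E\<^esub> (t \<otimes>\<^bsub>E\<^esub> (\<one>\<^bsub>E\<^esub> \<ominus>\<^bsub>E\<^esub> e a)) \<oplus>\<^bsub>E\<^esub>
        (e k \<otimes>\<^bsub>E\<^esub> e a) \<otimes>\<^bsub>E\<^esub> (\<one>\<^bsub>E\<^esub> \<ominus>\<^bsub>E\<^esub> s)"
        using eE g t s unfolding g'_def by (simp add: E.r_distr E.m_assoc s_def)
      ultimately show ?thesis using eE g t s hom_mult[of "e k \<otimes>\<^bsub>E\<^esub> g"] hom_mult[of "e k \<otimes>\<^bsub>E\<^esub> e a"]
        by (simp del: hom_mult hom_minus)
    qed
    moreover have "g' (finsum M v F) = finsum M v F \<and> (finsum M v F = \<zero> \<longrightarrow> (\<forall>i\<in>F. v i = \<zero>))"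
      if v: "\<forall>i\<in>F. v i \<in> carrier M \<and> e i (v i) = v i" for v
    proof -
      define w where "w = finsum M v G"
      have w: "w \<in> carrier M" using v G unfolding w_def by (intro M.finsum_closed) auto
      have va: "v a \<in> carrier M" "e a (v a) = v a" using v a by auto
      have fin: "finsum M v F = v a \<oplus> w" unfolding w_def G(3) using v G by (intro M.finsum_insert) auto
      have gw: "g w = w" "w = \<zero> \<Longrightarrow> \<forall>i\<in>G. v i = \<zero>" using gv[of v] v G unfolding w_def by auto
      have jw: "e a w = j w" using w gw by (simp add: j_def)
      have "(\<one>\<^bsub>E\<^esub> \<ominus>\<^bsub>E\<^esub> e a) (v a \<oplus> w) = (v a \<oplus> w) \<ominus> (v a \<oplus> j w)"
        using va w eE jw End_add[OF eE] by simp
      also have "\<dots> = w \<ominus> j w"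
        using va w jE End_closed[OF jE w] M.a_comm[of "v a" w]
        by (simp add: M.minus_eq M.minus_add M.a_assoc M.r_neg1 M.r_neg2)
      also have "\<dots> = (\<one>\<^bsub>E\<^esub> \<ominus>\<^bsub>E\<^esub> j) w" using w jE by simp
      finally have "(t \<otimes>\<^bsub>E\<^esub> (\<one>\<^bsub>E\<^esub> \<ominus>\<^bsub>E\<^esub> e a)) (v a \<oplus> w) = (t \<otimes>\<^bsub>E\<^esub> (\<one>\<^bsub>E\<^esub> \<ominus>\<^bsub>E\<^esub> j)) w"
        using va w by (simp del: End_app_minus)
      then have sw: "s (v a \<oplus> w) = w" using gw(1) va w t(2) by (simp add: s_def del: End_app_minus)
      have "v a \<oplus> w \<ominus> w = v a" using va w by (simp add: M.minus_eq M.a_assoc M.r_neg)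
      then have "g' (v a \<oplus> w) = w \<oplus> v a" using sw va w s eE by (simp add: g'_def)
      then have "g' (v a \<oplus> w) = v a \<oplus> w" using M.a_comm[OF va(1) w] by (rule trans[OF _ sym])
      moreover have "\<forall>i\<in>F. v i = \<zero>" if z: "v a \<oplus> w = \<zero>"
      proof -
        have "w = \<zero>" using sw s unfolding z by simp
        then show ?thesis using z va gw(2) G(3) by auto
      qed
      ultimately show ?thesis unfolding fin by (intro conjI impI)
    qed
    ultimately show ?thesis using g' by blast
  qed
qed

text \<open>The map \<open>\<Psi> = \<Sum> a i \<theta> (p i)\<close> from \<open>A\<close> to
  \<open>M\<close> restricts along \<open>\<phi>\<close> to the unit \<open>u\<close>, so its kernel
  is a complement of \<open>M'\<close>. By independence of the ranges of the \<open>a i\<close>, an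
  element lies in the kernel only if each of its components does; so the kernel is the direct sum of
  the submodules of \<open>B i\<close> killed by \<open>a i \<theta>\<close>.\<close>

lemma partition_complement:
  fixes R :: "('k, 'c) ring_scheme" and M :: "('k, 'a, 'd) rmod_scheme" and A :: "('k, 'b, 'e) rmod_scheme"
    and B :: "'i \<Rightarrow> 'b set"
  assumes M: "right_module R M" and A: "right_module R A"
    and \<phi>: "module_hom_on R M (carrier M) A \<phi>" "\<phi> ` carrier M = M'"
    and \<theta>: "module_hom_on R A (carrier A) M \<theta>" "\<And>m. m \<in> carrier M \<Longrightarrow> \<theta> (\<phi> m) = m"
    and B: "\<And>i. i \<in> I \<Longrightarrow> submodule R A (B i)" and M': "submodule R A M'"
    and p: "\<And>i. p i \<in> carrier (End R A)" "\<And>b. b \<in> carrier A \<Longrightarrow> family_in A I B (\<lambda>i. p i b)"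
    "\<And>b. b \<in> carrier A \<Longrightarrow> fsum A (\<lambda>i. p i b) = b"
    "\<And>c j. family_in A I B c \<Longrightarrow> p j (fsum A c) = c j"
    and a: "\<And>i. a i \<in> carrier (End R M)"
    and indep: "\<And>c i. fin_family M c \<Longrightarrow> (\<And>i. c i \<in> a i ` carrier M) \<Longrightarrow> fsum M c = \<zero>\<^bsub>M\<^esub> \<Longrightarrow> c i = \<zero>\<^bsub>M\<^esub>"
    and u: "u \<in> Units (End R M)"
    "\<And>m. m \<in> carrier M \<Longrightarrow> u m = fsum M (\<lambda>i. a i (\<theta> (p i (\<phi> m))))"
  shows "\<exists>B'. (\<forall>i\<in>I. submodule R A (B' i) \<and> B' i \<subseteq> B i) \<and>
     internal_dsum A (insert None (Some ` I)) (case_option M' B')"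
proof -
  interpret M: right_mod R M by unfold_locales (rule M)
  interpret A: right_mod R A by unfold_locales (rule A)
  have \<phi>cl: "\<phi> m \<in> carrier A" if "m \<in> carrier M" for m using \<phi>(1) that by (auto simp: module_hom_on_def)
  have \<phi>neg: "\<phi> (\<ominus>\<^bsub>M\<^esub> m) = \<ominus>\<^bsub>A\<^esub> \<phi> m" "\<phi> \<zero>\<^bsub>M\<^esub> = \<zero>\<^bsub>A\<^esub>" if "m \<in> carrier M" for m
    using M.additive_zero_neg[OF A.is_abelian_group, of \<phi>] \<phi>(1) that by (auto simp: module_hom_on_def)
  have \<theta>cl: "\<theta> b \<in> carrier M" if "b \<in> carrier A" for b using \<theta>(1) that by (auto simp: module_hom_on_def)
  have \<theta>add: "\<theta> (b \<oplus>\<^bsub>A\<^esub> c) = \<theta> b \<oplus>\<^bsub>M\<^esub> \<theta> c" if "b \<in> carrier A" "c \<in> carrier A" for b c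
    using \<theta>(1) that by (auto simp: module_hom_on_def)
  have \<theta>ract: "\<theta> (ract A b r) = ract M (\<theta> b) r" if "b \<in> carrier A" "r \<in> carrier R" for b r
    using \<theta>(1) that by (auto simp: module_hom_on_def)
  have \<theta>0: "\<theta> \<zero>\<^bsub>A\<^esub> = \<zero>\<^bsub>M\<^esub>" and \<theta>neg: "\<And>b. b \<in> carrier A \<Longrightarrow> \<theta> (\<ominus>\<^bsub>A\<^esub> b) = \<ominus>\<^bsub>M\<^esub> \<theta> b"
    using A.additive_zero_neg[OF M.is_abelian_group, of \<theta>] \<theta>cl \<theta>add by auto
  define k where "k i b = a i (\<theta> b)" for i b
  have kcl: "k i b \<in> carrier M" if "b \<in> carrier A" for i b using a \<theta>cl that by (simp add: k_def)
  have kadd: "k i (b \<oplus>\<^bsub>A\<^esub> c) = k i b \<oplus>\<^bsub>M\<^esub> k i c" if "b \<in> carrier A" "c \<in> carrier A" for i b c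
    using a \<theta>cl \<theta>add that by (simp add: k_def M.End_add)
  have kneg: "k i (\<ominus>\<^bsub>A\<^esub> b) = \<ominus>\<^bsub>M\<^esub> k i b" if "b \<in> carrier A" for i b
    using a \<theta>cl \<theta>neg that by (simp add: k_def M.End_uminus)
  have k0: "k i \<zero>\<^bsub>A\<^esub> = \<zero>\<^bsub>M\<^esub>" for i using a \<theta>0 by (simp add: k_def)
  have kract: "k i (ract A b r) = ract M (k i b) r" if "b \<in> carrier A" "r \<in> carrier R" for i b r
    using a \<theta>cl \<theta>ract that by (simp add: k_def M.End_ract)
  define B' where "B' i = {b \<in> B i. k i b = \<zero>\<^bsub>M\<^esub>}" for i
  have BA: "b \<in> carrier A" if "b \<in> B i" "i \<in> I" for b i
    using B[OF that(2)] that(1) by (auto simp: submodule_def)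
  have B': "submodule R A (B' i)" if i: "i \<in> I" for i
    using B[OF i] BA[OF _ i] M.ract_zero_minus(1)
    unfolding submodule_def B'_def by (auto simp: kadd kneg k0 kract)
  have pcl: "p i b \<in> carrier A" if "b \<in> carrier A" for i b using p(1) that by simp
  have pfin: "fin_family A (\<lambda>i. p i b)" if "b \<in> carrier A" for b
    using p(2)[OF that] pcl[OF that] by (intro A.fin_familyI) (auto simp: family_in_def)
  have kfin: "fin_family M (\<lambda>i. k i (p i b))" if b: "b \<in> carrier A" for b
    by (rule M.fin_familyI'[OF _ _ A.fin_familyD(2)[OF pfin[OF b]]]) (use kcl pcl b k0 in auto)
  define \<Psi> where "\<Psi> b = fsum M (\<lambda>i. k i (p i b))" for b
  have \<Psi>u: "\<Psi> (\<phi> m) = u m" if "m \<in> carrier M" for m using u(2)[OF that] by (simp add: \<Psi>_def k_def)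
  have \<Psi>add: "\<Psi> (b \<oplus>\<^bsub>A\<^esub> c) = \<Psi> b \<oplus>\<^bsub>M\<^esub> \<Psi> c" if "b \<in> carrier A" "c \<in> carrier A" for b c
    using M.fsum_add[OF kfin[OF that(1)] kfin[OF that(2)]] that p(1) pcl
    by (simp add: \<Psi>_def A.End_add kadd)
  have \<Psi>cl: "\<Psi> b \<in> carrier M" if "b \<in> carrier A" for b using kfin[OF that] by (simp add: \<Psi>_def)
  have kpzero: "k i (p i b) = \<zero>\<^bsub>M\<^esub>" if b: "b \<in> carrier A" "\<Psi> b = \<zero>\<^bsub>M\<^esub>" for b i
    by (rule indep[OF kfin[OF b(1)]]) (use b \<theta>cl pcl in \<open>auto simp: \<Psi>_def k_def\<close>)
  have uE: "u \<in> carrier (End R M)" using u(1) by auto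
  obtain v where v: "v \<in> carrier (End R M)" "v \<otimes>\<^bsub>End R M\<^esub> u = \<one>\<^bsub>End R M\<^esub>" "u \<otimes>\<^bsub>End R M\<^esub> v = \<one>\<^bsub>End R M\<^esub>"
    using u(1) unfolding Units_def by blast
  have vu: "v (u m) = m" "u (v m) = m" if "m \<in> carrier M" for m
    using M.End_app(1)[OF that, of v u] M.End_app(1)[OF that, of u v] M.End_app(2)[OF that] v by simp_all
  let ?C = "case_option M' B'" let ?J = "insert None (Some ` I)"
  have C: "submodule R A (?C i)" if "i \<in> ?J" for i using that M' B' by auto
  have "internal_dsum A ?J ?C"
  proof (subst internal_dsum_iff[OF A.is_abelian_group], goal_cases)
    case (1 i) then show ?case using C[of i] by (auto simp: submodule_def)
  next
    case (2 i) then show ?case using C[of i] by (auto simp: submodule_def)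
  next
    case 3
    show ?case
    proof (intro conjI ballI allI impI)
      fix b assume b: "b \<in> carrier A"
      \<comment> \<open>The component in \<open>M'\<close>: subtracting \<open>\<phi> m\<close> from
        \<open>b\<close> leaves an element of the kernel of \<open>\<Psi>\<close>.\<close>
      define m where "m = v (\<Psi> b)"
      have m: "m \<in> carrier M" "\<phi> m \<in> carrier A" using v \<Psi>cl[OF b] \<phi>cl by (auto simp: m_def)
      define b0 where "b0 = b \<oplus>\<^bsub>A\<^esub> \<phi> (\<ominus>\<^bsub>M\<^esub> m)"
      have b0: "b0 \<in> carrier A" using b m \<phi>cl by (simp add: b0_def)
      have "\<Psi> b0 = \<Psi> b \<oplus>\<^bsub>M\<^esub> \<ominus>\<^bsub>M\<^esub> u m"
        using b m \<Psi>add[OF b, of "\<phi> (\<ominus>\<^bsub>M\<^esub> m)"] \<phi>cl \<Psi>u[of "\<ominus>\<^bsub>M\<^esub> m"] M.End_uminus[OF uE m(1)] by (simp add: b0_def)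
      then have "\<Psi> b0 = \<zero>\<^bsub>M\<^esub>" using vu(2)[OF \<Psi>cl[OF b]] \<Psi>cl[OF b] by (simp add: m_def M.r_neg)
      then have kz: "k i (p i b0) = \<zero>\<^bsub>M\<^esub>" for i using kpzero b0 by blast
      define c where "c = case_option (\<phi> m) (\<lambda>i. p i b0)"
      have pI: "\<And>i. i \<in> I \<Longrightarrow> p i b0 \<in> B i" "\<And>i. i \<notin> I \<Longrightarrow> p i b0 = \<zero>\<^bsub>A\<^esub>" "finite {i. p i b0 \<noteq> \<zero>\<^bsub>A\<^esub>}"
        using p(2)[OF b0] by (auto simp: family_in_def)
      have "{i. c i \<noteq> \<zero>\<^bsub>A\<^esub>} \<subseteq> insert None (Some ` {i. p i b0 \<noteq> \<zero>\<^bsub>A\<^esub>})"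
      proof
        fix i assume "i \<in> {i. c i \<noteq> \<zero>\<^bsub>A\<^esub>}"
        then show "i \<in> insert None (Some ` {i. p i b0 \<noteq> \<zero>\<^bsub>A\<^esub>})" by (cases i) (auto simp: c_def)
      qed
      then have cfin: "finite {i. c i \<noteq> \<zero>\<^bsub>A\<^esub>}" using pI(3) by (auto intro: finite_subset)
      have "c i \<in> ?C i" if "i \<in> ?J" for i using that \<phi>(2) m pI(1) kz by (auto simp: c_def B'_def)
      moreover have "c i = \<zero>\<^bsub>A\<^esub>" if "i \<notin> ?J" for i using that pI(2) by (cases i) (auto simp: c_def)
      ultimately have fam: "family_in A ?J ?C c" using cfin by (simp add: family_in_def)
      have "fin_family A c"
        by (rule A.fin_familyI[OF _ cfin]) (use m pcl b0 in \<open>auto simp: c_def split: option.splits\<close>)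
      from A.fsum_option(2)[OF this] have "fsum A c = \<phi> m \<oplus>\<^bsub>A\<^esub> b0" using p(3)[OF b0] by (simp add: c_def)
      also have "\<dots> = b" using b m \<phi>neg(1)[OF m(1)] A.a_comm[of "\<phi> m" b0] b0
        by (simp add: b0_def A.a_assoc A.l_neg)
      finally show "\<exists>c. family_in A ?J ?C c \<and> fsum A c = b" using fam by blast
    next
      fix c i assume c: "family_in A ?J ?C c \<and> fsum A c = \<zero>\<^bsub>A\<^esub>"
      define d where "d i = c (Some i)" for i
      have fam: "\<And>i. i \<in> ?J \<Longrightarrow> c i \<in> ?C i" "\<And>i. i \<notin> ?J \<Longrightarrow> c i = \<zero>\<^bsub>A\<^esub>" "finite {i. c i \<noteq> \<zero>\<^bsub>A\<^esub>}"
        using conjunct1[OF c] unfolding family_in_def by blast+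
      have cfin: "fin_family A c"
      proof (rule A.family_in_fin_family[of ?J ?C])
        show "?C i \<subseteq> carrier A" if "i \<in> ?J" for i using C[OF that] unfolding submodule_def by (elim conjE)
      qed (rule conjunct1[OF c])
      have dfin: "fin_family A d" "c None \<oplus>\<^bsub>A\<^esub> fsum A d = \<zero>\<^bsub>A\<^esub>"
        using A.fsum_option[OF cfin] c by (simp_all add: d_def[abs_def])
      have dB': "d i \<in> B' i" if "i \<in> I" for i using fam(1)[of "Some i"] that by (simp add: d_def)
      have d0: "d i = \<zero>\<^bsub>A\<^esub>" if "i \<notin> I" for i using fam(2)[of "Some i"] that by (auto simp: d_def)
      have dfam: "family_in A I B d" using dB' d0 A.fin_familyD(2)[OF dfin(1)] by (auto simp: family_in_def B'_def)
      have "c None \<in> M'" using fam(1)[of None] by simp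
      then obtain m where m: "m \<in> carrier M" "c None = \<phi> m" using \<phi>(2) by auto
      have sd: "fsum A d = \<phi> (\<ominus>\<^bsub>M\<^esub> m)"
      proof -
        have "fsum A d \<oplus>\<^bsub>A\<^esub> \<phi> m = \<zero>\<^bsub>A\<^esub>"
          using dfin(2) m \<phi>cl A.fsum_closed[OF dfin(1)] A.a_comm[of "\<phi> m" "fsum A d"] by simp
        then show ?thesis using A.minus_equality[of "fsum A d" "\<phi> m"] m \<phi>cl \<phi>neg(1) dfin(1) by simp
      qed
      \<comment> \<open>\<open>\<Psi>\<close> vanishes on the part from the \<open>B' i\<close>, so
        the relation forces \<open>u (- m) = 0\<close> and hence \<open>m = 0\<close>; what remains
        is uniqueness in the original decomposition.\<close>
      have "k i (d i) = \<zero>\<^bsub>M\<^esub>" for i using dB' d0 k0 by (cases "i \<in> I") (auto simp: B'_def)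
      then have "\<Psi> (fsum A d) = \<zero>\<^bsub>M\<^esub>" by (simp add: \<Psi>_def p(4)[OF dfam])
      then have "u (\<ominus>\<^bsub>M\<^esub> m) = \<zero>\<^bsub>M\<^esub>" using sd \<Psi>u m by simp
      then have "\<ominus>\<^bsub>M\<^esub> m = \<zero>\<^bsub>M\<^esub>" using vu(1)[of "\<ominus>\<^bsub>M\<^esub> m"] m v(1) by simp
      then have "m = \<zero>\<^bsub>M\<^esub>" using m(1) M.minus_minus[of m] by simp
      then have z: "c None = \<zero>\<^bsub>A\<^esub>" "fsum A d = \<zero>\<^bsub>A\<^esub>" using m sd \<phi>neg(2) M.minus_equality[of "\<zero>\<^bsub>M\<^esub>" "\<zero>\<^bsub>M\<^esub>"] by auto
      have "d i = \<zero>\<^bsub>A\<^esub>" for i using p(4)[OF dfam, of i] z(2) p(1)[of i] by simp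
      then show "c i = \<zero>\<^bsub>A\<^esub>" using z(1) by (cases i) (auto simp: d_def)
    qed
  qed
  then show ?thesis using B' by (intro exI[of _ B']) (auto simp: B'_def)
qed

theorem theorem6:
  fixes R :: "('k, 'c) ring_scheme" and M :: "('k, 'a, 'd) rmod_scheme"
  assumes "right_module R M"
    and "C2 R M"
    and "dedekind_finite (End R M)"
    and "semi_pi_regular (End R M)"
  shows "\<forall>(A :: ('k, 'b) rmod) (I :: 'i set). right_module R A \<longrightarrow> exchange_wrt R M A I"
  unfolding exchange_wrt_def
proof (intro allI impI, elim conjE)
  fix A :: "('k, 'b) rmod" and I :: "'i set" and M' N and B :: "'i \<Rightarrow> 'b set"
  assume A: "right_module R A" and M': "submodule R A M'" and N: "submodule R A N"
    and iso: "mod_iso R M (carrier M) A M'"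
    and ds2: "internal_dsum A (UNIV :: bool set) (\<lambda>b. if b then M' else N)"
    and B: "\<forall>i\<in>I. submodule R A (B i)" and ds: "internal_dsum A I B"
  interpret M: right_mod R M by unfold_locales (rule assms(1))
  interpret A: right_mod R A by unfold_locales (rule A)
  obtain \<phi> where \<phi>: "module_hom_on R M (carrier M) A \<phi>" "bij_betw \<phi> (carrier M) M'"
    using iso by (auto simp: mod_iso_def)
  have \<phi>cl: "\<phi> m \<in> carrier A" if "m \<in> carrier M" for m using \<phi>(1) that by (auto simp: module_hom_on_def)
  have \<phi>add: "\<phi> (m \<oplus>\<^bsub>M\<^esub> n) = \<phi> m \<oplus>\<^bsub>A\<^esub> \<phi> n" if "m \<in> carrier M" "n \<in> carrier M" for m n
    using \<phi>(1) that by (auto simp: module_hom_on_def)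
  have \<phi>ract: "\<phi> (ract M m r) = ract A (\<phi> m) r" if "m \<in> carrier M" "r \<in> carrier R" for m r
    using \<phi>(1) that by (auto simp: module_hom_on_def)
  have img: "\<phi> ` carrier M = M'" using \<phi>(2) by (simp add: bij_betw_def)
  have sub2: "submodule R A (if b then M' else N)" for b using M' N by simp
  obtain q where q: "\<And>i. q i \<in> carrier (End R A)"
    "\<And>b. b \<in> carrier A \<Longrightarrow> family_in A UNIV (\<lambda>b. if b then M' else N) (\<lambda>i. q i b)"
    "\<And>b. b \<in> carrier A \<Longrightarrow> fsum A (\<lambda>i. q i b) = b"
    "\<And>c j. family_in A UNIV (\<lambda>b. if b then M' else N) c \<Longrightarrow> q j (fsum A c) = c j"
    by (rule A.internal_dsum_projections[OF sub2 ds2]) (rule that)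
  have qM': "q True b \<in> M'" if "b \<in> carrier A" for b
    using q(2)[OF that] unfolding family_in_def by (metis (full_types) UNIV_I)
  have qid: "q True b = b" if b: "b \<in> M'" for b
  proof -
    let ?c = "\<lambda>i. if i then b else \<zero>\<^bsub>A\<^esub>"
    have "b \<in> carrier A" using b M' by (auto simp: submodule_def)
    moreover have "family_in A UNIV (\<lambda>b. if b then M' else N) ?c"
      using b N by (auto simp: family_in_def submodule_def)
    ultimately show ?thesis using q(4)[of ?c True] by (simp add: A.fsum_bool)
  qed
  define \<psi> where "\<psi> = inv_into (carrier M) \<phi>"
  have \<psi>\<phi>: "\<psi> (\<phi> m) = m" if "m \<in> carrier M" for m
    unfolding \<psi>_def using \<phi>(2) that by (meson bij_betw_inv_into_left)
  \<comment> \<open>The projection onto \<open>M'\<close> followed by the inverse of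
    \<open>\<phi>\<close>: a retraction of the embedding.\<close>
  define \<theta> where "\<theta> b = \<psi> (q True b)" for b
  have lift: "\<exists>m\<in>carrier M. q True b = \<phi> m" if "b \<in> carrier A" for b using qM'[OF that] img by auto
  have \<theta>: "module_hom_on R A (carrier A) M \<theta>"
    unfolding module_hom_on_def
  proof (intro conjI ballI)
    show "\<theta> \<in> carrier A \<rightarrow> carrier M" using lift \<psi>\<phi> by (fastforce simp: \<theta>_def)
    fix b assume b: "b \<in> carrier A"
    obtain m where m: "m \<in> carrier M" "q True b = \<phi> m" using lift b by blast
    { fix c assume c: "c \<in> carrier A"
      obtain n where n: "n \<in> carrier M" "q True c = \<phi> n" using lift c by blast
      have "q True (b \<oplus>\<^bsub>A\<^esub> c) = \<phi> (m \<oplus>\<^bsub>M\<^esub> n)" using q(1) b c m n by (simp add: A.End_add \<phi>add)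
      then show "\<theta> (b \<oplus>\<^bsub>A\<^esub> c) = \<theta> b \<oplus>\<^bsub>M\<^esub> \<theta> c" using m n \<psi>\<phi> by (simp add: \<theta>_def) }
    fix r assume r: "r \<in> carrier R"
    have "q True (ract A b r) = \<phi> (ract M m r)" using q(1) b r m by (simp add: A.End_ract \<phi>ract)
    then show "\<theta> (ract A b r) = ract M (\<theta> b) r" using m r \<psi>\<phi> by (simp add: \<theta>_def)
  qed
  have \<theta>\<phi>: "\<theta> (\<phi> m) = m" if "m \<in> carrier M" for m
    using that qid[of "\<phi> m"] img \<psi>\<phi> by (auto simp: \<theta>_def)
  have \<theta>cl: "\<theta> b \<in> carrier M" if "b \<in> carrier A" for b using \<theta> that by (auto simp: module_hom_on_def)
  have \<theta>add: "\<theta> (b \<oplus>\<^bsub>A\<^esub> c) = \<theta> b \<oplus>\<^bsub>M\<^esub> \<theta> c" if "b \<in> carrier A" "c \<in> carrier A" for b c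
    using \<theta> that by (auto simp: module_hom_on_def)
  have \<theta>ract: "\<theta> (ract A b r) = ract M (\<theta> b) r" if "b \<in> carrier A" "r \<in> carrier R" for b r
    using \<theta> that by (auto simp: module_hom_on_def)
  have \<theta>0: "\<theta> \<zero>\<^bsub>A\<^esub> = \<zero>\<^bsub>M\<^esub>"
    using A.additive_zero_neg(1)[OF M.is_abelian_group, of \<theta>] \<theta>cl \<theta>add by auto
  obtain p where p: "\<And>i. p i \<in> carrier (End R A)" "\<And>b. b \<in> carrier A \<Longrightarrow> family_in A I B (\<lambda>i. p i b)"
    "\<And>b. b \<in> carrier A \<Longrightarrow> fsum A (\<lambda>i. p i b) = b"
    "\<And>c j. family_in A I B c \<Longrightarrow> p j (fsum A c) = c j"
    by (rule A.internal_dsum_projections[OF _ ds]) (use B in blast, rule that)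
  have pfin: "fin_family A (\<lambda>i. p i b)" if "b \<in> carrier A" for b
    using p(2)[OF that] p(1) that by (intro A.fin_familyI) (auto simp: family_in_def)
  \<comment> \<open>As the projections \<open>p i\<close> sum to the identity on \<open>A\<close>,
    these sum to \<open>\<theta>\<close> after \<open>\<phi>\<close>, which is the identity on
    \<open>M\<close>.\<close>
  define x where "x i = (\<lambda>m\<in>carrier M. \<theta> (p i (\<phi> m)))" for i
  have x_app: "x i m = \<theta> (p i (\<phi> m))" if "m \<in> carrier M" for i m using that by (simp add: x_def)
  have xE: "x i \<in> carrier (End R M)" for i
    unfolding x_def using p(1) \<phi>cl
    by (intro M.restrict_in_End) (simp_all add: \<theta>cl \<theta>add \<theta>ract \<phi>add \<phi>ract A.End_add A.End_ract)
  have summable: "M.summable_family x"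
    unfolding M.summable_family_def
  proof (intro conjI allI ballI)
    fix m assume m: "m \<in> carrier M"
    show "finite {i. x i m \<noteq> \<zero>\<^bsub>M\<^esub>}"
      by (rule finite_subset[OF _ A.fin_familyD(2)[OF pfin[OF \<phi>cl[OF m]]]]) (use x_app[OF m] \<theta>0 in auto)
  qed (rule xE)
  have sum_one: "M.esum x = \<one>\<^bsub>End R M\<^esub>"
  proof (rule M.End_eqI)
    fix m assume m: "m \<in> carrier M"
    have "M.esum x m = fsum M (\<lambda>i. \<theta> (p i (\<phi> m)))" using m by (simp add: M.esum_app x_app)
    also have "\<dots> = \<theta> (fsum A (\<lambda>i. p i (\<phi> m)))"
      by (rule A.fsum_additive[OF M.is_abelian_group]) (use \<theta>cl \<theta>add pfin[OF \<phi>cl[OF m]] in auto)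
    finally show "M.esum x m = \<one>\<^bsub>End R M\<^esub> m" using m p(3)[OF \<phi>cl[OF m]] \<theta>\<phi> by simp
  qed (use M.esum_closed[OF summable] in auto)
  \<comment> \<open>The whole index type is well-ordered. Outside \<open>I\<close> the projections
    \<open>p i\<close> are zero, hence so are the \<open>x i\<close>.\<close>
  obtain r :: "'i rel" where r: "Well_order r" "Field r = UNIV"
    using well_ordering by (elim exE conjE) (rule that)
  define lt where "lt i j \<longleftrightarrow> (i, j) \<in> r - Id" for i j
  have lt_eq: "{(i, j). lt i j} = r - Id" by (auto simp: lt_def)
  let ?J = "jacobson (End R M)"
  interpret partition_of_one R M "End R M Quot ?J" "(+>\<^bsub>End R M\<^esub>) ?J" x lt
  proof (intro partition_of_one.intro semi_pi_mod.intro partition_of_one_axioms.intro)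
    show "right_mod R M" by unfold_locales
    show "semi_pi_hom (End R M) (End R M Quot ?J) ((+>\<^bsub>End R M\<^esub>) ?J)"
      by (rule M.E.semi_pi_hom_jacobson[OF assms(4)])
    show "wf {(i, j). lt i j}" unfolding lt_eq using r by (simp add: well_order_on_def)
    fix i j k
    show "i = j \<or> lt i j \<or> lt j i"
      using r unfolding well_order_on_def linear_order_on_def total_on_def lt_def by auto
    assume "lt i j" "lt j k"
    then show "lt i k"
      using r unfolding well_order_on_def linear_order_on_def partial_order_on_def preorder_on_def lt_def
      by (metis DiffD1 DiffD2 DiffI antisymD pair_in_Id_conv transD)
  qed (use assms(2) summable sum_one in auto)
  obtain e a where a: "\<And>i. a i \<in> carrier (End R M)" and e: "\<And>i. e i = a i \<otimes>\<^bsub>End R M\<^esub> x i"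
    and idem: "\<And>i. e i \<otimes>\<^bsub>End R M\<^esub> e i = e i"
    and tri: "\<forall>k l. lt k l \<longrightarrow> ?J +>\<^bsub>End R M\<^esub> (e k \<otimes>\<^bsub>End R M\<^esub> e l) = \<zero>\<^bsub>End R M Quot ?J\<^esub>"
    and unit: "M.esum e \<in> Units (End R M)"
    by (rule triangular_partition[OF assms(3)]) (rule that)
  have eE: "e i \<in> carrier (End R M)" for i using a xE e by simp
  \<comment> \<open>The extra factor \<open>e i\<close> leaves the product with \<open>x i\<close>
    unchanged and puts the range of \<open>a' i\<close> inside that of \<open>e i\<close>, where
    independence is available.\<close>
  define a' where "a' i = e i \<otimes>\<^bsub>End R M\<^esub> a i" for i
  have a'E: "a' i \<in> carrier (End R M)" for i using a eE by (simp add: a'_def)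
  have a'x: "a' i \<otimes>\<^bsub>End R M\<^esub> x i = e i" for i
    using M.E.m_assoc[OF eE a xE, of i i i] idem[of i] by (simp add: a'_def flip: e)
  have ea': "e i (a' i m) = a' i m" if m: "m \<in> carrier M" for i m
  proof -
    have "e i (a' i m) = e i (e i (a i m))" using m by (simp add: a'_def)
    also have "\<dots> = (e i \<otimes>\<^bsub>End R M\<^esub> e i) (a i m)" using m a by simp
    finally show ?thesis using m by (simp add: idem a'_def)
  qed
  show "\<exists>Ai'. (\<forall>i\<in>I. submodule R A (Ai' i) \<and> Ai' i \<subseteq> B i) \<and>
    internal_dsum A (insert None (Some ` I)) (case_option M' Ai')"
  proof (rule partition_complement[OF assms(1) A \<phi>(1) img \<theta> \<theta>\<phi> _ M' p a'E _ unit])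
    show "submodule R A (B i)" if "i \<in> I" for i using B that by blast
    fix c i assume c: "fin_family M c" "\<And>i. c i \<in> a' i ` carrier M" "fsum M c = \<zero>\<^bsub>M\<^esub>"
    have ec: "c i \<in> carrier M \<and> e i (c i) = c i" for i
      using c(2)[of i] ea' a'E by auto
    have "\<forall>i\<in>{i. c i \<noteq> \<zero>\<^bsub>M\<^esub>}. c i = \<zero>\<^bsub>M\<^esub>"
      using triangular_independent[of e, OF eE idem tri M.fin_familyD(2)[OF c(1)]] ec c(3)
      unfolding fsum_def by blast
    then show "c i = \<zero>\<^bsub>M\<^esub>" by blast
  next
    fix m assume m: "m \<in> carrier M"
    have "e i m = a' i (\<theta> (p i (\<phi> m)))" for i
      using M.End_app(1)[OF m, of "a' i" "x i"] a'x[of i] x_app[OF m] by simp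
    then show "M.esum e m = fsum M (\<lambda>i. a' i (\<theta> (p i (\<phi> m))))" by (simp add: M.esum_app[OF m])
  qed
qed

end
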